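(* Let $g$ be a $C^1$ function near $0$ in $\mathbb{R}$ with $g(0)=0$, $g'(0)>0$, and consider the system in $\mathbb{R}^4$ (coordinates $(x,y,\dot x,\dot y)$) \[ \ddot x=-g(x),\qquad \ddot y=-g'(x)\,y . \] Then the origin of $\mathbb{R}^4$ is a (Lyapunov) stable equilibrium of this system if and only if the origin of $\mathbb{R}^2$ is a locally isochronous center for $\ddot x=-g(x)$; in this case all orbits of the system with $(x,\dot x)$ near $(0,0)$ are periodic and have the same period. If the equilibrium is unstable, then there is a sequence of initial data converging to the origin whose corresponding solutions are unbounded, and the instability is weak, i.e. there are no asymptotic motions to the equilibrium: no solution (other than the equilibrium itself) tends to the origin as $t\to-\infty$.
   Context: Let $V(x)=\int_0^x g(s)\,ds$. The origin of $\mathbb{R}^2$ is a locally isochronous center for $\ddot x=-g(x)$ if there is an open interval $J\ni0$ such that $V$ is strictly increasing on $J\cap(0,\infty)$, strictly decreasing on $J\cap(-\infty,0)$, for each $x\in J$ there is a unique $h(x)\in J$ with $V(h(x))=V(x)$ and $\operatorname{sgn}h(x)=-\operatorname{sgn}x$, and all orbits of $\ddot x=-g(x)$ in the $(x,\dot x)$-plane meeting $J\times\{0\}$ (which are periodic orbits enclosing the origin) have the same period. *)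

theory Defs
  imports "HOL-Analysis.Analysis"
begin

text \<open>The function g is only meaningful on an open set U containing 0 (its domain,
  where it is C^1). All solutions are required to have x(t) in U.
  States of the 4-dimensional system are (x, y, x', y') :: real * real * real * real,
  with the (Euclidean) product norm.\<close>

definition sys4_solution ::
  "real set \<Rightarrow> (real \<Rightarrow> real) \<Rightarrow> real set \<Rightarrow> (real \<Rightarrow> real \<times> real \<times> real \<times> real) \<Rightarrow> bool" where
  "sys4_solution U g I z \<longleftrightarrow> is_interval I \<and>
     (\<forall>t\<in>I. fst (z t) \<in> U \<and>
        ((\<lambda>s. fst (z s)) has_real_derivative fst (snd (snd (z t)))) (at t within I) \<and>
        ((\<lambda>s. fst (snd (z s))) has_real_derivative snd (snd (snd (z t)))) (at t within I) \<and>
        ((\<lambda>s. fst (snd (snd (z s)))) has_real_derivative - g (fst (z t))) (at t within I) \<and>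
        ((\<lambda>s. snd (snd (snd (z s)))) has_real_derivative
            - deriv g (fst (z t)) * fst (snd (z t))) (at t within I))"

definition sys2_solution ::
  "real set \<Rightarrow> (real \<Rightarrow> real) \<Rightarrow> real set \<Rightarrow> (real \<Rightarrow> real \<times> real) \<Rightarrow> bool" where
  "sys2_solution U g I w \<longleftrightarrow> is_interval I \<and>
     (\<forall>t\<in>I. fst (w t) \<in> U \<and>
        ((\<lambda>s. fst (w s)) has_real_derivative snd (w t)) (at t within I) \<and>
        ((\<lambda>s. snd (w s)) has_real_derivative - g (fst (w t))) (at t within I))"

definition lyap_stable :: "real set \<Rightarrow> (real \<Rightarrow> real) \<Rightarrow> bool" where
  "lyap_stable U g \<longleftrightarrow>
     (\<forall>\<epsilon>>0. \<exists>\<delta>>0. \<forall>p. norm p < \<delta> \<longrightarrow>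
        (\<exists>z. sys4_solution U g {0..} z \<and> z 0 = p) \<and>
        (\<forall>z I. sys4_solution U g I z \<and> 0 \<in> I \<and> I \<subseteq> {0..} \<and> z 0 = p \<longrightarrow>
               (\<forall>t\<in>I. norm (z t) < \<epsilon>)))"

definition potential :: "(real \<Rightarrow> real) \<Rightarrow> real \<Rightarrow> real" where
  "potential g x = (if 0 \<le> x then integral {0..x} g else - integral {x..0} g)"

definition loc_iso_center :: "real set \<Rightarrow> (real \<Rightarrow> real) \<Rightarrow> bool" where
  "loc_iso_center U g \<longleftrightarrow>
    (\<exists>a b. a < 0 \<and> 0 < b \<and> {a<..<b} \<subseteq> U \<and>
       (\<forall>x\<in>{0<..<b}. \<forall>y\<in>{0<..<b}. x < y \<longrightarrow> potential g x < potential g y) \<and>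
       (\<forall>x\<in>{a<..<0}. \<forall>y\<in>{a<..<0}. x < y \<longrightarrow> potential g x > potential g y) \<and>
       (\<forall>x\<in>{a<..<b}. \<exists>!h. h \<in> {a<..<b} \<and> potential g h = potential g x \<and> sgn h = - sgn x) \<and>
       (\<exists>T>0. \<forall>x0\<in>{a<..<b}. x0 \<noteq> 0 \<longrightarrow>
          (\<exists>w. sys2_solution U g UNIV w \<and> w 0 = (x0, 0) \<and>
               (\<forall>t. w (t + T) = w t) \<and> (\<forall>s\<in>{0<..<T}. w s \<noteq> w 0))))"

end

theory Submission
  imports Defs
begin

text \<open>
  Extend g from a small interval to a function G on the line with \<open>0 < m \<le> G' \<le> M\<close>, and let V
  be its potential. With \<open>psi x = sgn x * sqrt (2 V x)\<close> and \<open>phi\<close> its inverse, every motion of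
  \<open>x'' = - G x\<close> is \<open>x = phi (r sin u)\<close>, \<open>x' = r cos u\<close>, where the angle u runs through time by
  \<open>dt = f (r sin u) du\<close>, \<open>f = phi'\<close>. So the period is \<open>T r = \<integral>\<^sub>0\<^bsup>2\<pi>\<^esup> f (r sin u) du\<close>.

  Differentiating this family in r gives an explicit solution of the variational equation
  \<open>y'' = - G' x y\<close>, namely \<open>c2 = f (r sin u) sin u - K cos u\<close>, where K is the primitive of
  \<open>kap (r sin u)\<close> and \<open>kap s = s phi'' s\<close> is continuous with \<open>kap 0 = 0\<close>, although \<open>phi''\<close> need not
  exist at 0. The other basic solution is \<open>cos u = x' / r\<close>. After one turn c2 changes by
  \<open>- q r cos u\<close>, where \<open>q r = K (2\<pi>) = r T' r\<close>. Hence if q vanishes for all small r, then T is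
  constant and all solutions are periodic with uniform bounds; otherwise there are arbitrarily
  small r for which c2 grows linearly along the turns.
\<close>

section \<open>Primitives, inverse functions and uniqueness\<close>

lemma has_real_derivative_potential:
  assumes "continuous_on UNIV f"
  shows "(potential f has_real_derivative f x) (at x)"
proof -
  define N where "N = \<bar>x\<bar> + 1"
  have int: "f integrable_on {a..b}" for a b
    using assms continuous_on_subset integrable_continuous_real by blast
  \<comment> \<open>Moving the base point from 0 to \<open>-N\<close> removes the case split on the
    sign of y, so the fundamental theorem of calculus applies across 0.\<close>
  have eq: "potential f y = integral {-N..y} f - integral {-N..0} f" if "y \<in> {-N<..<N}" for y
  proof (cases "0 \<le> y")
    case True
    have "integral {-N..0} f + integral {0..y} f = integral {-N..y} f"
      by (rule Henstock_Kurzweil_Integration.integral_combine) (use True int in \<open>auto simp: N_def\<close>)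
    then show ?thesis using True by (simp add: potential_def)
  next
    case False
    have "integral {-N..y} f + integral {y..0} f = integral {-N..0} f"
      by (rule Henstock_Kurzweil_Integration.integral_combine) (use False that int in auto)
    then show ?thesis using False by (simp add: potential_def)
  qed
  have x: "x \<in> {-N<..<N}" by (auto simp: N_def)
  have "((\<lambda>y. integral {-N..y} f) has_real_derivative f x) (at x within {-N..N})"
    by (rule integral_has_real_derivative) (use assms x continuous_on_subset in auto)
  then have "((\<lambda>y. integral {-N..y} f) has_real_derivative f x) (at x)"
    using x at_within_Icc_at[of "-N" x N] by simp
  then have "((\<lambda>y. integral {-N..y} f - integral {-N..0} f) has_real_derivative f x) (at x)"
    by (auto intro!: derivative_eq_intros)
  then show ?thesis
    by (rule has_field_derivative_transform_within_open[of _ _ _ "{-N<..<N}"]) (use x eq in auto)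
qed

lemma potential_0 [simp]: "potential f 0 = 0"
  by (simp add: potential_def)

lemma continuous_on_potential:
  "continuous_on UNIV f \<Longrightarrow> continuous_on S (potential f)"
  by (meson DERIV_continuous_on has_real_derivative_potential has_field_derivative_at_within)

lemma potential_cong:
  assumes "\<And>t. \<bar>t\<bar> \<le> \<bar>x\<bar> \<Longrightarrow> f t = g t"
  shows "potential f x = potential g x"
  unfolding potential_def using assms
  by (auto intro!: Henstock_Kurzweil_Integration.integral_cong)

text \<open>By periodicity of \<open>f\<close> the increment \<open>F (x + p) - F x\<close> has
  derivative 0. This gives the change of \<open>tau\<close> and \<open>K\<close> over one
  turn.\<close>

lemma DERIV_add_period:
  assumes "\<And>x. (F has_real_derivative f x) (at x)" "\<And>x. f (x + p) = f x"
  shows "F (x + p) = F x + (F p - F (0::real))"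
proof -
  have "((\<lambda>x. F (x + p) - F x) has_real_derivative 0) (at x)" for x
    using assms(1)[of x] assms(1)[of "x+p"] assms(2)[of x]
    by (auto intro!: derivative_eq_intros simp: DERIV_shift)
  then have "F (x + p) - F x = F (0 + p) - F 0"
    using DERIV_isconst_all by blast
  then show ?thesis by simp
qed

text \<open>A derivative of at least c > 0 forces linear growth in both directions, so the
  intermediate value theorem gives surjectivity. The lemma inverts both \<open>psi\<close> (energy
  coordinate) and \<open>tau\<close> (time as a function of the angle).\<close>

lemma expanding_bij:
  fixes F f :: "real \<Rightarrow> real"
  assumes D: "\<And>x. (F has_real_derivative f x) (at x)" and c: "c > 0" "\<And>x. c \<le> f x"
  shows "bij F" "strict_mono F" "(inv F has_real_derivative inverse (f (inv F y))) (at y)"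
proof -
  show mono: "strict_mono F"
  proof (rule strict_monoI)
    show "F x < F y" if "x < y" for x y
    proof (rule DERIV_pos_imp_increasing[OF that])
      show "\<exists>y. (F has_real_derivative y) (at z) \<and> 0 < y" for z
        using D[of z] less_le_trans[OF c(1) c(2)[of z]] by (intro exI conjI)
    qed
  qed
  have cont: "isCont F x" for x using D DERIV_isCont by blast
  have grow: "c * (y - x) \<le> F y - F x" if xy: "x < y" for x y
  proof -
    obtain z where "F y - F x = (y - x) * f z" using MVT2[OF xy D] by blast
    then show ?thesis using c(2)[of z] xy by (simp add: mult.commute)
  qed
  have "\<exists>x. F x = y" for y
  proof -
    \<comment> \<open>At distance b from 0 the guaranteed growth \<open>c * b\<close> exceeds the
      distance from \<open>F 0\<close> to y.\<close>
    define b where "b = (\<bar>y - F 0\<bar> + 1) / c"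
    have b: "b > 0" "c * b = \<bar>y - F 0\<bar> + 1" using c by (auto simp: b_def)
    have "F (-b) \<le> y" "y \<le> F b" using grow[of "-b" 0] grow[of 0 b] b by auto
    then show ?thesis using IVT[of F "-b" y b] b cont by auto
  qed
  then have surj: "surj F" by (metis surjI)
  then show bij: "bij F" using mono by (simp add: bij_def strict_mono_imp_inj_on)
  have inv: "inv F (F x) = x" "F (inv F y) = y" for x y
    using bij by (simp_all add: bij_is_inj surj surj_f_inv_f)
  have "isCont (inv F) (F x)" for x
    by (rule isCont_inverse_function[of 1]) (use inv cont in auto)
  then have "isCont (inv F) y" by (metis inv(2))
  then show "(inv F has_real_derivative inverse (f (inv F y))) (at y)"
    by (intro DERIV_inverse_function[where f = F and a = "y - 1" and b = "y + 1"] D)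
       (use less_le_trans[OF c] inv in \<open>auto simp: less_imp_neq[symmetric]\<close>)
qed

section \<open>Uniqueness for second-order equations on arbitrary intervals\<close>

lemma at_within_interior_Ioo:
  "{a<..<b} \<subseteq> I \<Longrightarrow> a < t \<Longrightarrow> t < b \<Longrightarrow> at t within I = at (t::real)"
  by (metis at_within_interior greaterThanLessThan_iff interior_maximal open_greaterThanLessThan subsetD)

lemma interval_segment: "is_interval I \<Longrightarrow> a \<in> I \<Longrightarrow> b \<in> I \<Longrightarrow> {a..b} \<subseteq> (I::real set)"
  by (meson atLeastAtMost_iff is_interval_1 subsetI)

lemma has_real_derivative_reflect:
  assumes "(f has_real_derivative D) (at (-t) within I)"
  shows "((\<lambda>s. f (- s)) has_real_derivative - D) (at t within uminus ` I)"
proof -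
  have "(f has_real_derivative D) (at (- t) within uminus ` uminus ` I)"
    using assms by (simp add: image_image)
  then show ?thesis
    using DERIV_image_chain[of f D uminus t "uminus ` I" "-1"]
    by (auto intro!: derivative_eq_intros simp: o_def intro: DERIV_minus[OF DERIV_ident, simplified])
qed

text \<open>The function \<open>exp (- L * u) * N u\<close> has nonpositive derivative and starts at
  0, so \<open>N t\<close> is at most 0.\<close>

lemma gronwall_zero_forward:
  fixes N :: "real \<Rightarrow> real"
  assumes I: "is_interval I" "s \<in> I" "t \<in> I" "s \<le> t"
    and D: "\<And>t. t \<in> I \<Longrightarrow> (N has_real_derivative N' t) (at t within I)"
    and L: "\<And>t. t \<in> I \<Longrightarrow> N' t \<le> L * N t"
    and N: "N s = 0" "N t \<ge> 0"
  shows "N t = 0"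
proof (cases "s = t")
  case False
  have sub: "{s..t} \<subseteq> I" using I interval_segment by blast
  define F where "F u = exp (- L * u) * N u" for u
  have DF: "(F has_real_derivative (exp (- L * u) * (N' u - L * N u))) (at u within I)" if "u \<in> I" for u
    unfolding F_def by (auto intro!: derivative_eq_intros D that simp: algebra_simps)
  have "continuous_on {s..t} F"
    by (rule continuous_on_subset[OF DERIV_continuous_on sub]) (rule DF)
  moreover have "(F has_real_derivative (exp (- L * u) * (N' u - L * N u))) (at u)" if "s < u" "u < t" for u
  proof -
    have "{s<..<t} \<subseteq> I" using sub by auto
    then show ?thesis using DF[of u] at_within_interior_Ioo[of s t I u] that by auto
  qed
  ultimately obtain l z where z: "s < z" "z < t" "F t - F s = (t - s) * (exp (- L * z) * (N' z - L * N z))"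
    using MVT[of s t F] False I(4) DERIV_unique unfolding real_differentiable_def
    by (metis (no_types, lifting) less_eq_real_def)
  have "N' z - L * N z \<le> 0" using L[of z] z subsetD[OF sub, of z] by auto
  then have "F t \<le> 0"
    using z mult_nonneg_nonpos[of "(t - s) * exp (- L * z)" "N' z - L * N z"] N(1)
    by (simp add: F_def mult.assoc)
  then show ?thesis using N(2) unfolding F_def by (simp add: mult_le_0_iff not_le)
qed (use N in simp)

text \<open>Gronwall applied to \<open>u\<^sup>2 + v\<^sup>2\<close>; times before s are reached by
  reversing time. It is applied to the difference of two solutions.\<close>

lemma second_order_zero:
  fixes u v w :: "real \<Rightarrow> real"
  assumes I: "is_interval I" "s \<in> I" "t \<in> I"
    and u: "\<And>t. t \<in> I \<Longrightarrow> (u has_real_derivative v t) (at t within I)"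
    and v: "\<And>t. t \<in> I \<Longrightarrow> (v has_real_derivative w t) (at t within I)"
    and w: "\<And>t. t \<in> I \<Longrightarrow> \<bar>w t\<bar> \<le> L * \<bar>u t\<bar>"
    and init: "u s = 0" "v s = 0"
  shows "u t = 0 \<and> v t = 0"
proof -
  define N N' where "N t = (u t)\<^sup>2 + (v t)\<^sup>2" and "N' t = 2 * v t * (u t + w t)" for t
  have DN: "(N has_real_derivative N' t) (at t within I)" if "t \<in> I" for t
    unfolding N_def N'_def
    by (auto intro!: derivative_eq_intros u v that simp: algebra_simps)
  have bound: "\<bar>N' t\<bar> \<le> (1 + \<bar>L\<bar>) * N t" if "t \<in> I" for t
  proof -
    \<comment> \<open>No sign is assumed for L, hence the constant with its absolute value.\<close>
    have "\<bar>u t + w t\<bar> \<le> (1 + \<bar>L\<bar>) * \<bar>u t\<bar>"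
    proof -
      have "L * \<bar>u t\<bar> \<le> \<bar>L\<bar> * \<bar>u t\<bar>" by (rule mult_right_mono) auto
      then show ?thesis using w[OF that] abs_triangle_ineq[of "u t" "w t"] by (simp add: distrib_right)
    qed
    then have "\<bar>N' t\<bar> \<le> 2 * \<bar>v t\<bar> * ((1 + \<bar>L\<bar>) * \<bar>u t\<bar>)"
      unfolding N'_def abs_mult by (intro mult_mono) auto
    also have "\<dots> = (1 + \<bar>L\<bar>) * (2 * \<bar>u t\<bar> * \<bar>v t\<bar>)" by simp
    also have "\<dots> \<le> (1 + \<bar>L\<bar>) * N t"
      unfolding N_def using sum_squares_bound[of "\<bar>u t\<bar>" "\<bar>v t\<bar>"] by (intro mult_left_mono) auto
    finally show ?thesis .
  qed
  have N0: "N s = 0" "N t \<ge> 0" by (auto simp: N_def init)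
  have "N t = 0"
  proof (cases "s \<le> t")
    case True
    show ?thesis
      by (rule gronwall_zero_forward[OF I True DN _ N0, where L = "1 + \<bar>L\<bar>"]) (use bound abs_le_iff in blast)+
  next
    case False
    have "N (- (- t)) = 0"
    proof (rule gronwall_zero_forward[where N = "\<lambda>t. N (- t)" and N' = "\<lambda>t. - N' (- t)"
          and I = "uminus ` I" and s = "- s" and L = "1 + \<bar>L\<bar>"])
      show "is_interval (uminus ` I)" using I(1) by simp
      show "((\<lambda>t. N (- t)) has_real_derivative - N' (- x)) (at x within uminus ` I)"
        if "x \<in> uminus ` I" for x
        by (rule has_real_derivative_reflect) (use DN that in auto)
      show "- N' (- x) \<le> (1 + \<bar>L\<bar>) * N (- x)" if "x \<in> uminus ` I" for x
        using bound[of "- x"] that by auto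
    qed (use I False N0 in auto)
    then show ?thesis by simp
  qed
  then show ?thesis by (simp add: N_def sum_power2_eq_zero_iff)
qed

section \<open>The energy coordinate\<close>

text \<open>A restoring force on the whole line. The two-sided bound on the derivative makes the
  later changes of variable bijections of the line and all estimates uniform in the
  amplitude.\<close>

locale oscillator =
  fixes G G' :: "real \<Rightarrow> real" and m M :: real
  assumes DERIV_G: "\<And>x. (G has_real_derivative G' x) (at x)"
    and cont_G': "continuous_on UNIV G'"
    and G_0: "G 0 = 0"
    and m_pos: "m > 0"
    and G'_bounds: "\<And>x. m \<le> G' x" "\<And>x. G' x \<le> M"
begin

text \<open>With the limits at 0 filled in, \<open>A\<close> and \<open>B\<close> are the factors
  that turn x into the force and x^2 into twice the potential. They are positive and continuous, so
  \<open>psi\<close> can be handled across 0 without division by x.\<close>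

definition "A x = (if x = 0 then G' 0 else G x / x)"
definition "B x = (if x = 0 then G' 0 else 2 * potential G x / x\<^sup>2)"

lemma cont_G: "continuous_on S G"
  by (meson DERIV_G DERIV_continuous_on has_field_derivative_at_within)

lemma deriv_G: "deriv G = G'"
  using DERIV_G DERIV_imp_deriv by blast

lemma DERIV_V: "(potential G has_real_derivative G x) (at x)"
  by (rule has_real_derivative_potential[OF cont_G])

lemma G_eq: "G x = x * A x"
  by (simp add: A_def G_0)

lemma V_eq: "2 * potential G x = x\<^sup>2 * B x"
  by (simp add: B_def)

lemma A_mean: "\<exists>z. A x = G' z"
proof -
  consider "x < 0" | "x = 0" | "0 < x" by linarith
  then show ?thesis
  proof cases
    case 1
    from MVT2[OF this DERIV_G] obtain z where "G 0 - G x = (0 - x) * G' z" by blast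
    then show ?thesis using 1 by (auto simp: A_def G_0 field_simps)
  next
    case 3
    from MVT2[OF this DERIV_G] obtain z where "G x - G 0 = (x - 0) * G' z" by blast
    then show ?thesis using 3 by (auto simp: A_def G_0 field_simps)
  qed (auto simp: A_def)
qed

text \<open>Cauchy's mean value theorem for the potential and t^2, with h as auxiliary function.
  Locating z no further from 0 than x is what gives continuity of \<open>B\<close> at 0.\<close>

lemma B_mean: "\<exists>z. \<bar>z\<bar> \<le> \<bar>x\<bar> \<and> B x = A z"
proof (cases "x = 0")
  case False
  define h where "h t = potential G t * x\<^sup>2 - potential G x * t\<^sup>2" for t
  have Dh: "(h has_real_derivative (G t * x\<^sup>2 - potential G x * (2 * t))) (at t)" for t
    unfolding h_def by (auto intro!: derivative_eq_intros DERIV_V)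
  have "h 0 = h x" by (simp add: h_def)
  have "\<exists>z. z \<noteq> 0 \<and> \<bar>z\<bar> \<le> \<bar>x\<bar> \<and> G z * x\<^sup>2 - potential G x * (2 * z) = 0"
  proof (cases "0 < x")
    case True
    obtain z where "0 < z" "z < x" "h x - h 0 = (x - 0) * (G z * x\<^sup>2 - potential G x * (2 * z))"
      using MVT2[OF True Dh] by blast
    then show ?thesis using \<open>h 0 = h x\<close> True by (intro exI[of _ z]) auto
  next
    case F: False
    then have "x < 0" using False by simp
    then obtain z where "x < z" "z < 0" "h 0 - h x = (0 - x) * (G z * x\<^sup>2 - potential G x * (2 * z))"
      using MVT2[OF _ Dh] by blast
    then show ?thesis using \<open>h 0 = h x\<close> \<open>x < 0\<close> by (intro exI[of _ z]) auto
  qed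
  then obtain z where z: "z \<noteq> 0" "\<bar>z\<bar> \<le> \<bar>x\<bar>" "G z * x\<^sup>2 = potential G x * (2 * z)"
    by auto
  then have "B x = A z"
    using False by (simp add: A_def B_def divide_simps)
  then show ?thesis using z(2) by blast
qed (auto simp: A_def B_def)

lemma A_bounds: "m \<le> A x" "A x \<le> M"
  using A_mean[of x] G'_bounds by metis+

lemma B_bounds: "m \<le> B x" "B x \<le> M"
  using B_mean[of x] A_bounds by metis+

lemma A_pos: "0 < A x" and B_pos: "0 < B x" and M_pos: "0 < M"
  using A_bounds[of x] B_bounds[of x] m_pos by linarith+

lemma eventually_nhds_nonzero: "x \<noteq> 0 \<Longrightarrow> \<forall>\<^sub>F y in nhds x. y \<noteq> (0::real)"
  using eventually_nhds_in_open[of "- {0}" x] by (simp add: open_Compl)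

lemma cont_A: "isCont A x"
proof (cases "x = 0")
  case True
  have "((\<lambda>h. (G (0 + h) - G 0) / h) \<longlongrightarrow> G' 0) (at 0)"
    using DERIV_G[of 0] unfolding DERIV_def .
  also have "?this \<longleftrightarrow> (A \<longlongrightarrow> A 0) (at 0)"
    unfolding A_def[of 0]
    by (simp, rule tendsto_cong) (auto simp: A_def G_0 eventually_at intro!: exI[of _ 1])
  finally show ?thesis using True by (simp add: isCont_def)
next
  case False
  have "isCont (\<lambda>x. G x / x) x"
    using False DERIV_isCont[OF DERIV_G] by (intro continuous_intros) auto
  also have "?this \<longleftrightarrow> isCont A x"
    by (rule isCont_cong, rule eventually_mono[OF eventually_nhds_nonzero[OF False]])
       (simp add: A_def)
  finally show ?thesis .
qed

lemma DERIV_B: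
  assumes "x \<noteq> 0"
  shows "(B has_real_derivative 2 * (A x - B x) / x) (at x)"
proof -
  have "((\<lambda>x. 2 * potential G x / x\<^sup>2) has_real_derivative 2 * (A x - B x) / x) (at x)"
    using assms
    by (auto intro!: derivative_eq_intros DERIV_V simp: A_def B_def field_simps power2_eq_square)
  then show ?thesis
    by (rule has_field_derivative_transform_within_open[of _ _ _ "- {0}"])
       (use assms in \<open>auto simp: B_def\<close>)
qed

lemma cont_B: "isCont B x"
proof (cases "x = 0")
  case True
  show ?thesis unfolding True continuous_at_eps_delta
  proof (intro allI impI)
    fix e :: real assume "e > 0"
    then obtain d where d: "d > 0" "\<And>y. dist y 0 < d \<Longrightarrow> dist (A y) (A 0) < e"
      using cont_A[of 0] unfolding continuous_at_eps_delta by blast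
    have "dist (B y) (B 0) < e" if "dist y 0 < d" for y
    proof -
      \<comment> \<open>Since z is at least as close to 0 as y, continuity of \<open>A\<close> at 0
        carries over to \<open>B\<close>.\<close>
      obtain z where z: "\<bar>z\<bar> \<le> \<bar>y\<bar>" "B y = A z" using B_mean by blast
      moreover have "B 0 = A 0" by (simp add: A_def B_def)
      ultimately show ?thesis using d(2)[of z] that by simp
    qed
    then show "\<exists>d>0. \<forall>y. dist y 0 < d \<longrightarrow> dist (B y) (B 0) < e" using d(1) by blast
  qed
qed (use DERIV_B DERIV_isCont in blast)

text \<open>\<open>kap s\<close> equals \<open>s phi'' s\<close> for \<open>s \<noteq> 0\<close>; the formula below also makes sense at 0,
  where \<open>phi\<close> is in general only once differentiable with continuous derivative.\<close>

definition "psi x = x * sqrt (B x)"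
definition "phi = inv psi"
definition "f s = sqrt (B (phi s)) / A (phi s)"
definition "kap s = f s * (1 - (f s)\<^sup>2 * G' (phi s))"

lemma psi_sq: "(psi x)\<^sup>2 = 2 * potential G x"
  using B_pos[of x] by (simp add: psi_def power_mult_distrib V_eq)

lemma DERIV_psi: "(psi has_real_derivative A x / sqrt (B x)) (at x)"
proof (cases "x = 0")
  case True
  \<comment> \<open>At 0 the difference quotient of \<open>psi\<close> is \<open>sqrt (B h)\<close>
    itself, so continuity of \<open>B\<close> suffices where \<open>B\<close> need not be
    differentiable.\<close>
  have "((\<lambda>h. sqrt (B h)) \<longlongrightarrow> sqrt (B 0)) (at 0)"
    using cont_B[of 0] by (simp add: isCont_def tendsto_real_sqrt)
  also have "?this \<longleftrightarrow> ((\<lambda>h. (psi (0 + h) - psi 0) / h) \<longlongrightarrow> sqrt (B 0)) (at 0)"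
    by (rule tendsto_cong) (auto simp: psi_def eventually_at intro!: exI[of _ 1])
  also have "sqrt (B 0) = A 0 / sqrt (B 0)"
    using B_pos[of 0] real_div_sqrt[of "B 0"] by (simp add: A_def B_def)
  finally show ?thesis using True by (simp add: DERIV_def)
next
  case False
  have "sqrt (B x) * sqrt (B x) = B x" using B_pos[of x] by simp
  then show ?thesis
    unfolding psi_def[abs_def] using False B_pos[of x]
    by (auto intro!: derivative_eq_intros DERIV_B DERIV_chain2[where f = sqrt] DERIV_real_sqrt simp: field_simps)
qed

lemma psi'_lower: "m / sqrt M \<le> A x / sqrt (B x)"
  using A_bounds B_bounds B_pos A_pos m_pos by (intro frac_le) (auto simp: less_imp_le)

lemma psi_bij: "bij psi" and psi_mono: "strict_mono psi"
  and DERIV_phi: "(phi has_real_derivative f s) (at s)"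
  using expanding_bij[OF DERIV_psi _ psi'_lower] m_pos M_pos
  by (auto simp: phi_def f_def)

lemma phi_psi [simp]: "phi (psi x) = x" and psi_phi [simp]: "psi (phi s) = s"
  using psi_bij by (simp_all add: phi_def bij_is_inj bij_is_surj surj_f_inv_f)

lemma psi_0 [simp]: "psi 0 = 0"
  by (simp add: psi_def)

lemma phi_0 [simp]: "phi 0 = 0"
  using phi_psi[of 0] by simp

lemma phi_less_iff [simp]: "phi s < phi t \<longleftrightarrow> s < t"
  by (metis psi_phi psi_mono strict_mono_less)

lemma psi_less_iff [simp]: "psi s < psi t \<longleftrightarrow> s < t"
  by (simp add: psi_mono strict_mono_less)

lemma cont_phi: "isCont phi s"
  using DERIV_phi DERIV_isCont by blast

lemma cont_f: "continuous_on S f" and cont_kap: "continuous_on S kap"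
proof -
  have "isCont G' x" for x using cont_G' by (simp add: continuous_on_eq_continuous_at)
  then have "isCont (\<lambda>s. B (phi s)) s" "isCont (\<lambda>s. A (phi s)) s" "isCont (\<lambda>s. G' (phi s)) s" for s
    by (auto intro: isCont_o2[OF cont_phi] cont_A cont_B)
  moreover have "A (phi s) \<noteq> 0" for s using A_pos[of "phi s"] by simp
  ultimately have "isCont f s" "isCont kap s" for s
    unfolding f_def[abs_def] kap_def[abs_def] by (intro continuous_intros; simp)+
  then show "continuous_on S f" "continuous_on S kap"
    by (simp_all add: continuous_at_imp_continuous_on)
qed

lemma f_bounds: "sqrt m / M \<le> f s" "f s \<le> sqrt M / m"
  unfolding f_def using A_bounds B_bounds A_pos B_pos m_pos M_pos
  by (auto intro!: frac_le simp: less_imp_le)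

lemma f_pos: "0 < f s"
  using A_pos B_pos by (simp add: f_def)

lemma kap_bounded: "\<exists>C>0. \<forall>s. \<bar>kap s\<bar> \<le> C"
proof -
  define F where "F = sqrt M / m"
  have F: "F > 0" using m_pos M_pos by (simp add: F_def)
  have "\<bar>kap s\<bar> \<le> F * (1 + F\<^sup>2 * M)" for s
  proof -
    have f: "0 < f s" "f s \<le> F" using f_pos f_bounds by (auto simp: F_def)
    then have "(f s)\<^sup>2 \<le> F\<^sup>2" by (intro power_mono) auto
    then have "(f s)\<^sup>2 * G' (phi s) \<le> F\<^sup>2 * M"
      using G'_bounds[of "phi s"] m_pos by (intro mult_mono) auto
    moreover have "0 \<le> (f s)\<^sup>2 * G' (phi s)"
      using G'_bounds[of "phi s"] m_pos by (intro mult_nonneg_nonneg) auto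
    ultimately have "\<bar>1 - (f s)\<^sup>2 * G' (phi s)\<bar> \<le> 1 + F\<^sup>2 * M" by linarith
    then show ?thesis
      unfolding kap_def abs_mult using f by (intro mult_mono) auto
  qed
  moreover have "F * (1 + F\<^sup>2 * M) > 0"
    using F M_pos by (intro mult_pos_pos add_pos_nonneg) auto
  ultimately show ?thesis by blast
qed

text \<open>This is the derivative in s of the relation
  \<open>2 * potential G (phi s) = s\<^sup>2\<close>.\<close>

lemma G_phi_f: "G (phi s) * f s = s"
  using A_pos[of "phi s"] psi_phi[of s] by (simp add: G_eq f_def psi_def)

lemma G_phi: "G (phi s) = s / f s"
  using G_phi_f[of s] f_pos[of s] by (simp add: field_simps)

lemma f_0_sq: "(f 0)\<^sup>2 * G' 0 = 1"
  using B_pos[of 0] by (simp add: f_def A_def B_def power_divide) (simp add: power2_eq_square)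

lemma kap_0 [simp]: "kap 0 = 0"
  by (simp add: kap_def f_0_sq)

text \<open>Away from 0, \<open>f s\<close> is the quotient of s by \<open>G (phi s)\<close>, and
  both terms are differentiable. The result identifies \<open>kap s\<close> as s times the second
  derivative of \<open>phi\<close>.\<close>

lemma DERIV_f:
  assumes "s \<noteq> 0"
  shows "(f has_real_derivative kap s / s) (at s)"
proof -
  have nz: "G (phi s) \<noteq> 0" "f s \<noteq> 0" using G_phi_f[of s] assms by auto
  have "((\<lambda>s. s / G (phi s)) has_real_derivative
          (1 * G (phi s) - s * (G' (phi s) * f s)) / (G (phi s) * G (phi s))) (at s)"
    using nz by (intro DERIV_divide DERIV_ident DERIV_chain2[OF DERIV_G DERIV_phi]) auto
  also have "(1 * G (phi s) - s * (G' (phi s) * f s)) / (G (phi s) * G (phi s)) = kap s / s"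
    using nz unfolding kap_def G_phi using assms by (simp add: field_simps power2_eq_square)
  finally show ?thesis
    by (rule has_field_derivative_transform_within_open[of _ _ _ "- {0}"])
       (use assms f_pos in \<open>auto simp: G_phi less_imp_neq[symmetric]\<close>)
qed

text \<open>The factor s absorbs the possible singularity of the derivative of \<open>f\<close>: at
  0 the difference quotient is \<open>f h\<close>, which converges by continuity.\<close>

lemma DERIV_s_f: "((\<lambda>s. s * f s) has_real_derivative f s + kap s) (at s)"
proof (cases "s = 0")
  case True
  have "(f \<longlongrightarrow> f 0) (at 0)"
    using cont_f[of UNIV] by (simp add: continuous_on_eq_continuous_at isCont_def)
  also have "?this \<longleftrightarrow> ((\<lambda>h. ((0 + h) * f (0 + h) - 0 * f 0) / h) \<longlongrightarrow> f 0) (at 0)"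
    by (rule tendsto_cong) (auto simp: eventually_at intro!: exI[of _ 1])
  finally show ?thesis using True by (simp add: DERIV_def)
next
  case False
  then show ?thesis by (auto intro!: derivative_eq_intros DERIV_f)
qed

end

section \<open>Motion in the angle variable\<close>

lemma periodic_int:
  fixes h :: "real \<Rightarrow> 'a"
  assumes "\<And>x. h (x + p) = h x"
  shows "h (x + of_int n * p) = h x"
proof -
  have nat: "h (x + real n * p) = h x" for n x
  proof (induction n)
    case (Suc n)
    then show ?case using assms[of "x + real n * p"] by (simp add: algebra_simps)
  qed simp
  show ?thesis
  proof (cases "0 \<le> n")
    case True
    then show ?thesis using nat[of x "nat n"] by simp
  next
    case False
    then show ?thesis using nat[of "x + of_int n * p" "nat (- n)"] by simp
  qed
qed

lemma periodic_reduce: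
  fixes h :: "real \<Rightarrow> 'a"
  assumes "\<And>x. h (x + p) = h x" "p > 0"
  obtains y where "0 \<le> y" "y \<le> p" "h y = h x"
proof
  define n where "n = \<lfloor>x / p\<rfloor>"
  have "of_int n \<le> x / p" "x / p \<le> of_int n + 1" unfolding n_def by linarith+
  then have "of_int n * p \<le> x" "x \<le> (of_int n + 1) * p"
    using assms(2) by (simp_all add: pos_le_divide_eq pos_divide_le_eq)
  then show "0 \<le> x + of_int (- n) * p" "x + of_int (- n) * p \<le> p"
    by (simp_all add: algebra_simps)
  show "h (x + of_int (- n) * p) = h x" by (rule periodic_int[where h = h, OF assms(1)])
qed

context oscillator
begin

text \<open>\<open>tau r u\<close> is the time at which the orbit of amplitude r, started at angle
  0, has angle u; \<open>th r\<close> is the angle as a function of time. \<open>potential\<close>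
  serves here as the primitive vanishing at 0.\<close>

definition "tau r = potential (\<lambda>u. f (r * sin u))"
definition "th r = inv (tau r)"
definition "T r = tau r (2 * pi)"
definition "K r = potential (\<lambda>u. kap (r * sin u))"
definition "q r = K r (2 * pi)"

lemma DERIV_tau: "(tau r has_real_derivative f (r * sin u)) (at u)"
  unfolding tau_def
  by (rule has_real_derivative_potential)
     (intro continuous_on_compose2[OF cont_f[of UNIV]] continuous_intros; simp)

lemma DERIV_K: "(K r has_real_derivative kap (r * sin u)) (at u)"
  unfolding K_def
  by (rule has_real_derivative_potential)
     (intro continuous_on_compose2[OF cont_kap[of UNIV]] continuous_intros; simp)

lemma tau_0 [simp]: "tau r 0 = 0" and K_0 [simp]: "K r 0 = 0"
  by (simp_all add: tau_def K_def)

lemma K_zero_amplitude [simp]: "K 0 u = 0"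
  by (simp add: K_def potential_def)

lemma tau_add_period: "tau r (u + 2 * pi) = tau r u + T r"
  using DERIV_add_period[of "tau r" "\<lambda>u. f (r * sin u)", OF DERIV_tau] by (simp add: T_def)

lemma K_add_period: "K r (u + 2 * pi) = K r u + q r"
  using DERIV_add_period[of "K r" "\<lambda>u. kap (r * sin u)", OF DERIV_K] by (simp add: q_def)

lemma tau_bij: "bij (tau r)" and tau_mono: "strict_mono (tau r)"
  and DERIV_th: "(th r has_real_derivative inverse (f (r * sin (th r t)))) (at t)"
  using expanding_bij[OF DERIV_tau _ f_bounds(1)] m_pos M_pos
  by (auto simp: th_def)

lemma th_tau [simp]: "th r (tau r u) = u" and tau_th [simp]: "tau r (th r t) = t"
  using tau_bij by (simp_all add: th_def bij_is_inj bij_is_surj surj_f_inv_f)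

lemma th_less_iff [simp]: "th r s < th r t \<longleftrightarrow> s < t"
  by (metis tau_th tau_mono strict_mono_less)

lemma th_add_period: "th r (t + T r) = th r t + 2 * pi"
  by (metis tau_add_period tau_th th_tau)

lemma T_pos: "0 < T r"
  using strict_mono_less[OF tau_mono, of r 0 "2 * pi"] by (simp add: T_def)

text \<open>The pairs \<open>(cos u, d1 r u)\<close> and \<open>(c2 r u, d2 r u)\<close> solve the variational equation along the
  orbit of amplitude r. As r sin u is never divided by r, they remain correct for the equilibrium
  \<open>r = 0\<close>.\<close>

definition "c2 r u = sin u * f (r * sin u) - cos u * K r u"
definition "d1 r u = - sin u / f (r * sin u)"
definition "d2 r u = cos u + sin u * K r u / f (r * sin u)"

text \<open>The terms with \<open>K\<close> and the factors \<open>f\<close> cancel, leaving the sum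
  of the squares of sine and cosine. The value 1 lets \<open>Z_param\<close> solve for the
  coefficients without denominators.\<close>

lemma wronskian: "cos u * d2 r u - d1 r u * c2 r u = 1"
proof -
  have "cos u * d2 r u - d1 r u * c2 r u = (cos u)\<^sup>2 + (sin u)\<^sup>2"
    using f_pos[of "r * sin u"]
    by (simp add: c2_def d1_def d2_def algebra_simps add_divide_distrib diff_divide_distrib power2_eq_square)
  then show ?thesis by simp
qed

lemma DERIV_phi_sin:
  "((\<lambda>u. phi (r * sin u)) has_real_derivative f (r * sin u) * (r * cos u)) (at u)"
  by (rule DERIV_chain2[OF DERIV_phi]) (auto intro!: derivative_eq_intros)

text \<open>For r \<noteq> 0 this is \<open>DERIV_s_f\<close> at \<open>r * sin u\<close> divided by
  r. For r = 0 the factor \<open>f\<close> is constant and \<open>kap 0\<close> vanishes, so the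
  same formula holds.\<close>

lemma DERIV_sin_f:
  "((\<lambda>u. sin u * f (r * sin u)) has_real_derivative
     cos u * (f (r * sin u) + kap (r * sin u))) (at u)"
proof (cases "r = 0")
  case False
  have "((\<lambda>u. (r * sin u) * f (r * sin u)) has_real_derivative
     (f (r * sin u) + kap (r * sin u)) * (r * cos u)) (at u)"
    by (rule DERIV_chain2[OF DERIV_s_f]) (auto intro!: derivative_eq_intros)
  from DERIV_cdivide[OF this, of r] show ?thesis using False by (simp add: mult.commute)
qed (auto intro!: derivative_eq_intros)

text \<open>For r \<noteq> 0 the function equals \<open>G (phi (r * sin u)) / r\<close>, so no
  derivative of \<open>f\<close> enters. For r = 0 the formula reduces to
  \<open>f_0_sq\<close>.\<close>

lemma DERIV_sin_div_f:
  "((\<lambda>u. sin u / f (r * sin u)) has_real_derivative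
     cos u * (f (r * sin u) * G' (phi (r * sin u)))) (at u)"
proof (cases "r = 0")
  case True
  have "cos u / f 0 = cos u * (f 0 * G' 0)"
    using f_0_sq f_pos[of 0] by (simp add: field_simps power2_eq_square)
  then show ?thesis using True f_pos[of 0] by (auto intro!: derivative_eq_intros)
next
  case False
  have "((\<lambda>u. G (phi (r * sin u))) has_real_derivative
      G' (phi (r * sin u)) * (f (r * sin u) * (r * cos u))) (at u)"
    by (rule DERIV_chain2[OF DERIV_G DERIV_phi_sin])
  from DERIV_cdivide[OF this, of r] show ?thesis using False by (simp add: G_phi mult_ac)
qed

text \<open>Here and in \<open>DERIV_d1\<close>, \<open>DERIV_c2\<close>, \<open>DERIV_d2\<close>
  the angle derivative is written as \<open>f (r * sin u)\<close> times the time derivative, the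
  shape that \<open>DERIV_th_comp\<close> expects.\<close>

lemma DERIV_cos': "(cos has_real_derivative f (r * sin u) * d1 r u) (at u)"
  using f_pos[of "r * sin u"] by (auto intro!: derivative_eq_intros simp: d1_def)

lemma DERIV_d1:
  "(d1 r has_real_derivative f (r * sin u) * (- G' (phi (r * sin u)) * cos u)) (at u)"
  using DERIV_minus[OF DERIV_sin_div_f[of r u]] by (simp add: d1_def[abs_def] mult_ac)

lemma DERIV_c2: "(c2 r has_real_derivative f (r * sin u) * d2 r u) (at u)"
  unfolding c2_def[abs_def]
  by (rule DERIV_cong[OF DERIV_diff[OF DERIV_sin_f DERIV_mult[OF DERIV_cos DERIV_K]]])
     (use f_pos[of "r * sin u"] in \<open>simp add: d2_def field_simps\<close>)

lemma DERIV_d2: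
  "(d2 r has_real_derivative f (r * sin u) * (- G' (phi (r * sin u)) * c2 r u)) (at u)"
proof -
  have "d2 r = (\<lambda>u. cos u + (sin u / f (r * sin u)) * K r u)"
    by (auto simp: d2_def)
  moreover have "((\<lambda>u. cos u + (sin u / f (r * sin u)) * K r u) has_real_derivative
      f (r * sin u) * (- G' (phi (r * sin u)) * c2 r u)) (at u)"
    by (rule DERIV_cong[OF DERIV_add[OF DERIV_cos DERIV_mult[OF DERIV_sin_div_f DERIV_K]]])
       (use f_pos[of "r * sin u"] in \<open>simp add: c2_def kap_def field_simps power2_eq_square\<close>)
  ultimately show ?thesis by simp
qed

text \<open>The state at angle u on the orbit of amplitude r, with a general solution of the
  variational equation attached. At angle 0 it is \<open>(0, a, r, b)\<close>, so a and b are the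
  values of y and its velocity there.\<close>

definition "Z r a b u = (phi (r * sin u), a * cos u + b * c2 r u, r * cos u, a * d1 r u + b * d2 r u)"

text \<open>The angle moves at speed 1 / \<open>f\<close>, which cancels the factor
  \<open>f\<close>. The shift \<open>t0\<close> fixes the initial phase.\<close>

lemma DERIV_th_comp:
  assumes "\<And>u. (h has_real_derivative f (r * sin u) * D u) (at u)"
  shows "((\<lambda>t. h (th r (t + t0))) has_real_derivative D (th r (t + t0))) (at t within S)"
proof -
  have "((\<lambda>t. th r (t + t0)) has_real_derivative inverse (f (r * sin (th r (t + t0))))) (at t)"
    using DERIV_th[of r "t + t0"] by (simp add: DERIV_shift)
  from has_field_derivative_at_within[OF DERIV_chain2[OF assms this]] show ?thesis
    by (rule DERIV_cong) (use f_pos[of "r * sin (th r (t + t0))"] in simp)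
qed

lemma Z_solution:
  assumes "is_interval I"
  shows "sys4_solution UNIV G I (\<lambda>t. Z r a b (th r (t + t0)))"
proof -
  have nz: "f s \<noteq> 0" for s using f_pos[of s] by simp
  have "((\<lambda>u. r * cos u) has_real_derivative f (r * sin u) * - G (phi (r * sin u))) (at u)" for u
    using nz by (auto intro!: derivative_eq_intros simp: G_phi)
  moreover have "((\<lambda>u. a * cos u + b * c2 r u) has_real_derivative
      f (r * sin u) * (a * d1 r u + b * d2 r u)) (at u)" for u
    by (rule DERIV_cong[OF DERIV_add[OF DERIV_cmult[OF DERIV_cos'[of r]] DERIV_cmult[OF DERIV_c2]]])
       (simp add: algebra_simps)
  moreover have "((\<lambda>u. a * d1 r u + b * d2 r u) has_real_derivative
      f (r * sin u) * (- G' (phi (r * sin u)) * (a * cos u + b * c2 r u))) (at u)" for u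
    by (rule DERIV_cong[OF DERIV_add[OF DERIV_cmult[OF DERIV_d1] DERIV_cmult[OF DERIV_d2]]])
       (simp add: algebra_simps)
  ultimately show ?thesis
    unfolding sys4_solution_def Z_def fst_conv snd_conv deriv_G
    using assms by (intro conjI ballI DERIV_th_comp UNIV_I DERIV_phi_sin)
qed

section \<open>The period as a function of the amplitude\<close>

lemma T_eq: "T r = integral {0..2 * pi} (\<lambda>u. f (r * sin u))"
  by (simp add: T_def tau_def potential_def)

lemma q_eq: "q r = integral {0..2 * pi} (\<lambda>u. kap (r * sin u))"
  by (simp add: q_def K_def potential_def)

lemma cont_T: "continuous_on S T"
proof -
  have "continuous_on S (\<lambda>r. integral (cbox 0 (2 * pi)) (\<lambda>u. f (r * sin u)))"
    by (rule integral_continuous_on_param)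
       (auto simp: case_prod_beta intro!: continuous_on_compose2[OF cont_f[of UNIV]] continuous_intros)
  then show ?thesis by (simp add: T_eq[abs_def])
qed

text \<open>Differentiation under the integral sign: the r-derivative of
  \<open>f (r * sin u)\<close> is \<open>kap (r * sin u) / r\<close>, continuous in both variables
  for r > 0.\<close>

lemma DERIV_T:
  assumes "r > 0"
  shows "(T has_real_derivative q r / r) (at r)"
proof -
  have "((\<lambda>r. integral (cbox 0 (2 * pi)) (\<lambda>u. f (r * sin u))) has_field_derivative
        integral (cbox 0 (2 * pi)) (\<lambda>u. kap (r * sin u) / r)) (at r within {0<..})"
  proof (rule leibniz_rule_field_derivative)
    show "((\<lambda>r. f (r * sin u)) has_field_derivative kap (r * sin u) / r) (at r within {0<..})"
      if "r \<in> {0<..}" for r u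
    \<comment> \<open>Where the sine vanishes the integrand is the constant \<open>f 0\<close>,
      which agrees with \<open>kap 0 = 0\<close>.\<close>
    proof (cases "sin u = 0")
      case False
      have "((\<lambda>r. f (r * sin u)) has_field_derivative (kap (r * sin u) / (r * sin u)) * sin u) (at r)"
        using False that
        by (intro DERIV_chain2[OF DERIV_f]) (auto intro!: derivative_eq_intros)
      from has_field_derivative_at_within[OF this] show ?thesis
        by (rule DERIV_cong) (use False in simp)
    qed simp
    show "continuous_on ({0<..} \<times> cbox 0 (2 * pi)) (\<lambda>(r, u). kap (r * sin u) / r)"
      by (auto simp: case_prod_beta intro!: continuous_on_compose2[OF cont_kap[of UNIV]] continuous_intros)
    show "(\<lambda>u. f (r * sin u)) integrable_on cbox 0 (2 * pi)" for r
      by (intro integrable_continuous continuous_on_compose2[OF cont_f[of UNIV]] continuous_intros) simp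
  qed (use assms in auto)
  moreover have "at r within {0<..} = at r" using assms at_within_open[of r "{0<..}"] by auto
  ultimately show ?thesis by (simp add: T_eq[abs_def] q_eq)
qed

text \<open>The derivative formula covers r > 0 only; continuity at 0 brings in \<open>T 0\<close>,
  the period of the linearised motion.\<close>

lemma T_const:
  assumes "\<forall>r\<in>{0<..<R}. q r = 0" "0 \<le> r" "r < R"
  shows "T r = T 0"
proof (cases "r = 0")
  case False
  show ?thesis
  proof (rule DERIV_isconst_end[of 0 r T])
    show "(T has_real_derivative 0) (at x)" if "0 < x" "x < r" for x
      using DERIV_T[of x] assms that by simp
  qed (use False assms cont_T in auto)
qed simp

lemma q_zero:
  assumes T: "\<forall>r\<in>{0<..<R}. T r = c" and r: "r \<in> {0<..<R}"
  shows "q r = 0"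
proof -
  have "((\<lambda>_. c) has_real_derivative q r / r) (at r)"
    by (rule has_field_derivative_transform_within_open[OF DERIV_T, of _ "{0<..<R}"]) (use r T in auto)
  then have "q r / r = 0" using DERIV_unique DERIV_const by blast
  then show ?thesis using r by simp
qed

section \<open>Bounds and coordinates for the variational solutions\<close>

lemma Z_add_period:
  assumes "q r = 0"
  shows "Z r a b (u + 2 * pi) = Z r a b u"
  using assms by (simp add: Z_def c2_def d1_def d2_def K_add_period)

text \<open>\<open>f\<close>, its reciprocal and \<open>kap\<close> are bounded on the whole line,
  so the bound is uniform in r. It is restricted to one turn because \<open>K\<close> may grow from
  turn to turn.\<close>

lemma coeff_bounded:
  "\<exists>C\<ge>1. \<forall>r u. 0 \<le> u \<longrightarrow> u \<le> 2 * pi \<longrightarrow> \<bar>c2 r u\<bar> \<le> C \<and> \<bar>d1 r u\<bar> \<le> C \<and> \<bar>d2 r u\<bar> \<le> C"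
proof -
  obtain k where k: "k > 0" "\<And>s. \<bar>kap s\<bar> \<le> k" using kap_bounded by blast
  \<comment> \<open>Bounds for \<open>K\<close> over one turn, for \<open>f\<close>, and for the
    reciprocal of \<open>f\<close>.\<close>
  define P F L where "P = k * (2 * pi)" and "F = sqrt M / m" and "L = M / sqrt m"
  have PFL: "P \<ge> 0" "F \<ge> 0" "L \<ge> 0"
    using k m_pos M_pos by (auto simp: P_def F_def L_def)
  have bounds: "\<bar>c2 r u\<bar> \<le> 1 + F + P + L + P * L \<and> \<bar>d1 r u\<bar> \<le> 1 + F + P + L + P * L \<and> \<bar>d2 r u\<bar> \<le> 1 + F + P + L + P * L"
    if u: "0 \<le> u" "u \<le> 2 * pi" for r u
  proof -
    have "norm (integral {0..u} (\<lambda>u. kap (r * sin u))) \<le> k * (u - 0)"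
      by (rule integral_bound)
         (use u k in \<open>auto intro!: continuous_on_compose2[OF cont_kap[of UNIV]] continuous_intros\<close>)
    also have "\<dots> \<le> P" unfolding P_def using u k by (intro mult_left_mono) auto
    finally have K: "\<bar>K r u\<bar> \<le> P" using u by (simp add: K_def potential_def)
    let ?f = "f (r * sin u)"
    have f: "?f > 0" "?f \<le> F" using f_pos f_bounds by (auto simp: F_def)
    have "1 / ?f \<le> 1 / (sqrt m / M)"
      using f_bounds(1)[of "r * sin u"] m_pos M_pos by (intro frac_le) auto
    then have inv: "1 / ?f \<le> L" "0 \<le> 1 / ?f" using f by (simp_all add: L_def)
    have "\<bar>sin u * ?f\<bar> \<le> 1 * F"
      unfolding abs_mult using f by (intro mult_mono) auto
    moreover have "\<bar>cos u * K r u\<bar> \<le> 1 * P"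
      unfolding abs_mult using K by (intro mult_mono) auto
    moreover have d1: "\<bar>sin u * (1 / ?f)\<bar> \<le> 1 * L"
      unfolding abs_mult using inv by (intro mult_mono) auto
    moreover have "\<bar>K r u * (sin u * (1 / ?f))\<bar> \<le> P * L"
      unfolding abs_mult[of "K r u"] using d1 K PFL by (intro mult_mono) auto
    moreover have "\<bar>cos u\<bar> \<le> 1" by simp
    moreover have "c2 r u = sin u * ?f - cos u * K r u" "d1 r u = - (sin u * (1 / ?f))"
      "d2 r u = cos u + K r u * (sin u * (1 / ?f))"
      by (simp_all add: c2_def d1_def d2_def)
    moreover have "P * L \<ge> 0" using PFL by simp
    ultimately show ?thesis using PFL by linarith
  qed
  show ?thesis
    by (rule exI[of _ "1 + F + P + L + P * L"]) (use bounds PFL in auto)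
qed

text \<open>If \<open>q r\<close> vanishes then \<open>K r\<close>, and with it each coefficient,
  has period \<open>2 * pi\<close>, so the bound over one turn holds for all angles.\<close>

lemma coeff_bounded_periodic:
  "\<exists>C\<ge>1. \<forall>r u. q r = 0 \<longrightarrow> \<bar>c2 r u\<bar> \<le> C \<and> \<bar>d1 r u\<bar> \<le> C \<and> \<bar>d2 r u\<bar> \<le> C"
proof -
  obtain C where C: "C \<ge> 1"
    "\<And>r u. 0 \<le> u \<Longrightarrow> u \<le> 2 * pi \<Longrightarrow> \<bar>c2 r u\<bar> \<le> C \<and> \<bar>d1 r u\<bar> \<le> C \<and> \<bar>d2 r u\<bar> \<le> C"
    using coeff_bounded by blast
  have "\<bar>c2 r u\<bar> \<le> C \<and> \<bar>d1 r u\<bar> \<le> C \<and> \<bar>d2 r u\<bar> \<le> C" if "q r = 0" for r u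
  proof -
    have "(c2 r (x + 2 * pi), d1 r (x + 2 * pi), d2 r (x + 2 * pi)) = (c2 r x, d1 r x, d2 r x)" for x
      using that by (simp add: c2_def d1_def d2_def K_add_period)
    from periodic_reduce[where h = "\<lambda>x. (c2 r x, d1 r x, d2 r x)" and p = "2 * pi" and x = u, OF this]
    obtain y where "0 \<le> y" "y \<le> 2 * pi" "(c2 r y, d1 r y, d2 r y) = (c2 r u, d1 r u, d2 r u)"
      by auto
    then show ?thesis using C(2)[of y r] by simp
  qed
  then show ?thesis using C(1) by blast
qed

text \<open>Polar coordinates for \<open>(psi x, v)\<close> give the amplitude and an angle in the
  first turn; the remaining linear system for a and b has determinant 1 and bounded
  coefficients.\<close>

lemma Z_param:
  "\<exists>C\<ge>1. \<forall>x y v w. \<exists>u a b. 0 \<le> u \<and> (x, y, v, w) = Z (sqrt ((psi x)\<^sup>2 + v\<^sup>2)) a b u \<and>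
       \<bar>a\<bar> \<le> C * (\<bar>y\<bar> + \<bar>w\<bar>) \<and> \<bar>b\<bar> \<le> C * (\<bar>y\<bar> + \<bar>w\<bar>)"
proof -
  obtain C where C: "C \<ge> 1"
    "\<And>r u. 0 \<le> u \<Longrightarrow> u \<le> 2 * pi \<Longrightarrow> \<bar>c2 r u\<bar> \<le> C \<and> \<bar>d1 r u\<bar> \<le> C \<and> \<bar>d2 r u\<bar> \<le> C"
    using coeff_bounded by blast
  have "\<exists>u a b. 0 \<le> u \<and> (x, y, v, w) = Z (sqrt ((psi x)\<^sup>2 + v\<^sup>2)) a b u \<and>
       \<bar>a\<bar> \<le> C * (\<bar>y\<bar> + \<bar>w\<bar>) \<and> \<bar>b\<bar> \<le> C * (\<bar>y\<bar> + \<bar>w\<bar>)" for x y v w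
  proof -
    define r where "r = sqrt ((psi x)\<^sup>2 + v\<^sup>2)"
    have "\<exists>u. 0 \<le> u \<and> u \<le> 2 * pi \<and> psi x = r * sin u \<and> v = r * cos u"
    proof (cases "r = 0")
      case True
      \<comment> \<open>At amplitude 0 every angle represents the point.\<close>
      then show ?thesis by (intro exI[of _ 0]) (auto simp: r_def sum_power2_eq_zero_iff)
    next
      case False
      then have "(v / r)\<^sup>2 + (psi x / r)\<^sup>2 = 1"
        by (simp add: power_divide add_divide_distrib[symmetric] r_def add.commute)
      from sincos_total_2pi[OF this] obtain u where "0 \<le> u" "u < 2 * pi" "v / r = cos u" "psi x / r = sin u"
        by blast
      then show ?thesis using False by (intro exI[of _ u]) (auto simp: field_simps)
    qed
    then obtain u where u: "0 \<le> u" "u \<le> 2 * pi" "psi x = r * sin u" "v = r * cos u" by blast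
    \<comment> \<open>Cramer's rule with Wronskian 1.\<close>
    define a b where "a = y * d2 r u - w * c2 r u" and "b = w * cos u - y * d1 r u"
    have "phi (r * sin u) = x" using u(3)[symmetric] by simp
    moreover have "a * cos u + b * c2 r u = y * (cos u * d2 r u - d1 r u * c2 r u)"
      "a * d1 r u + b * d2 r u = w * (cos u * d2 r u - d1 r u * c2 r u)"
      by (simp_all add: a_def b_def algebra_simps)
    ultimately have "(x, y, v, w) = Z r a b u" using u(4) by (simp add: Z_def wronskian)
    moreover note Cu = C(2)[OF u(1,2), of r]
    have "\<bar>y * d2 r u\<bar> \<le> C * \<bar>y\<bar>" "\<bar>w * c2 r u\<bar> \<le> C * \<bar>w\<bar>" "\<bar>y * d1 r u\<bar> \<le> C * \<bar>y\<bar>"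
      using Cu by (simp_all add: abs_mult mult.commute[of C] mult_left_mono)
    moreover have "\<bar>w * cos u\<bar> \<le> C * \<bar>w\<bar>"
      using C(1) mult_mono[of "\<bar>cos u\<bar>" C "\<bar>w\<bar>" "\<bar>w\<bar>"] abs_cos_le_one[of u]
      by (simp add: abs_mult mult.commute)
    ultimately have "(x, y, v, w) = Z r a b u" "\<bar>a\<bar> \<le> C * (\<bar>y\<bar> + \<bar>w\<bar>)" "\<bar>b\<bar> \<le> C * (\<bar>y\<bar> + \<bar>w\<bar>)"
      unfolding a_def b_def distrib_left by linarith+
    then show ?thesis using u(1) unfolding r_def by blast
  qed
  then show ?thesis using C(1) by blast
qed

section \<open>Minimal periods and unbounded motions\<close>

lemma Z_zero_amplitude: "Z 0 a b u =
    (0, a * cos u + b * f 0 * sin u, 0, b * cos u - a / f 0 * sin u)"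
  by (simp add: Z_def c2_def d1_def d2_def)

text \<open>For r \<noteq> 0 the planar orbit already determines the angle modulo a full turn. For r
  = 0 the variational part is a nonzero harmonic oscillation and determines it instead.\<close>

lemma Z_eq_imp:
  assumes "Z r a b u = Z r a b u'" "Z r a b u \<noteq> 0"
  shows "sin u = sin u' \<and> cos u = cos u'"
proof (cases "r = 0")
  case False
  have "phi (r * sin u) = phi (r * sin u')" "cos u = cos u'"
    using assms(1) False by (simp_all add: Z_def)
  then show ?thesis using False by (metis mult_left_cancel psi_phi)
next
  case True
  define s c where "s = sin u - sin u'" and "c = cos u - cos u'"
  have nz: "f 0 \<noteq> 0" using f_pos[of 0] by simp
  have "a * c + (b * f 0) * s = 0"
    using assms(1) unfolding True Z_zero_amplitude s_def c_def by (simp add: algebra_simps)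
  moreover have "(b * f 0) * c - a * s = 0"
    using assms(1) nz unfolding True Z_zero_amplitude s_def c_def by (simp add: field_simps)
  \<comment> \<open>The two equations apply a scaled orthogonal matrix to (c, s); summing squares
    factors out its scale, which is nonzero.\<close>
  ultimately have "(a * c + (b * f 0) * s)\<^sup>2 + ((b * f 0) * c - a * s)\<^sup>2 = 0" by simp
  also have "(a * c + (b * f 0) * s)\<^sup>2 + ((b * f 0) * c - a * s)\<^sup>2 = (a\<^sup>2 + (b * f 0)\<^sup>2) * (c\<^sup>2 + s\<^sup>2)"
    by algebra
  finally have "a\<^sup>2 + (b * f 0)\<^sup>2 = 0 \<or> c\<^sup>2 + s\<^sup>2 = 0" by simp
  moreover have "a \<noteq> 0 \<or> b \<noteq> 0" using assms(2) unfolding True by (auto simp: Z_zero_amplitude zero_prod_def)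
  ultimately have "c = 0 \<and> s = 0" using nz by (auto simp: sum_power2_eq_zero_iff)
  then show ?thesis by (simp add: s_def c_def)
qed

text \<open>Equal states need angles differing by a multiple of \<open>2 * pi\<close>, whereas in a
  time strictly between 0 and \<open>T r\<close> the angle advances by strictly less than one
  turn.\<close>

lemma Z_minimal_period:
  assumes "Z r a b (th r t) \<noteq> 0" "0 < s" "s < T r"
  shows "Z r a b (th r (t + s)) \<noteq> Z r a b (th r t)"
proof
  assume eq: "Z r a b (th r (t + s)) = Z r a b (th r t)"
  then have "sin (th r (t + s)) = sin (th r t) \<and> cos (th r (t + s)) = cos (th r t)"
    using assms(1) by (intro Z_eq_imp[of r a b]) auto
  then obtain n where n: "th r (t + s) = th r t + 2 * pi * of_int n"
    using sin_cos_eq_iff by blast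
  have "th r t < th r (t + s)" "th r (t + s) < th r (t + T r)" using assms by simp_all
  then have "0 < 2 * pi * of_int n" "2 * pi * of_int n < 2 * pi * 1"
    by (simp_all add: n th_add_period)
  then have "0 < n" "n < 1" by (simp_all add: zero_less_mult_iff)
  then show False by presburger
qed

text \<open>Sampled after n full turns, where sine is 0 and cosine is 1, the y-component is
  \<open>- b * (real n * q r)\<close>.\<close>

lemma Z_unbounded:
  assumes "q r \<noteq> 0" "b \<noteq> 0"
  shows "\<not> bounded ((\<lambda>t. Z r 0 b (th r t)) ` {0..})"
proof
  assume "bounded ((\<lambda>t. Z r 0 b (th r t)) ` {0..})"
  then obtain C where C: "\<And>t. t \<ge> 0 \<Longrightarrow> norm (Z r 0 b (th r t)) \<le> C"
    unfolding bounded_iff by auto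
  have K: "K r (real n * (2 * pi)) = real n * q r \<and> 0 \<le> tau r (real n * (2 * pi))" for n
  proof (induction n)
    case (Suc n)
    have "real (Suc n) * (2 * pi) = real n * (2 * pi) + 2 * pi" by (simp add: algebra_simps)
    with Suc T_pos[of r] show ?case
      unfolding \<open>real (Suc n) * (2 * pi) = real n * (2 * pi) + 2 * pi\<close> K_add_period tau_add_period
      by (simp add: distrib_right)
  qed simp
  have "real n * \<bar>b * q r\<bar> \<le> C" for n
  proof -
    let ?u = "real n * (2 * pi)"
    have "sin ?u = 0" "cos ?u = 1"
      using periodic_int[of sin "2 * pi" 0 "int n"] periodic_int[of cos "2 * pi" 0 "int n"] by simp_all
    then have "Z r 0 b ?u = (0, - b * (real n * q r), r, b)"
      using K by (simp add: Z_def c2_def d1_def d2_def)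
    moreover have "norm (Z r 0 b ?u) \<le> C" using C[of "tau r ?u"] K[of n] by simp
    moreover have "\<bar>y\<bar> \<le> norm (x, y, v, w)" for x y v w :: real
      by (metis norm_fst_le norm_snd_le order_trans real_norm_def)
    ultimately have "\<bar>- b * (real n * q r)\<bar> \<le> C" by (metis order_trans)
    then show ?thesis by (simp add: abs_mult mult_ac)
  qed
  moreover obtain n where "C < real n * \<bar>b * q r\<bar>"
    using reals_Archimedean3[of "\<bar>b * q r\<bar>"] assms by auto
  ultimately show False by (meson not_less)
qed

end

section \<open>Uniqueness and confinement\<close>

lemma sys4_solution_sys2:
  "sys4_solution U g I z \<Longrightarrow> sys2_solution U g I (\<lambda>t. (fst (z t), fst (snd (snd (z t)))))"
  by (simp add: sys4_solution_def sys2_solution_def)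

lemma sys4_solution_subset:
  "sys4_solution U g I z \<Longrightarrow> J \<subseteq> I \<Longrightarrow> is_interval J \<Longrightarrow> sys4_solution U g J z"
  unfolding sys4_solution_def by (meson has_field_derivative_subset subsetD)

lemma sys2_solution_reflect:
  assumes "sys2_solution U g I w"
  shows "sys2_solution U g (uminus ` I) (\<lambda>t. (fst (w (- t)), - snd (w (- t))))"
  unfolding sys2_solution_def
proof (intro conjI ballI)
  show "is_interval (uminus ` I)" using assms by (simp add: sys2_solution_def)
  fix t assume "t \<in> uminus ` I"
  then have t: "- t \<in> I" by auto
  then show "fst (fst (w (- t)), - snd (w (- t))) \<in> U"
    using assms by (simp add: sys2_solution_def)
  have "((\<lambda>s. fst (w s)) has_real_derivative snd (w (- t))) (at (- t) within I)"
    "((\<lambda>s. snd (w s)) has_real_derivative - g (fst (w (- t)))) (at (- t) within I)"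
    using assms t by (simp_all add: sys2_solution_def)
  from has_real_derivative_reflect[OF this(1)] DERIV_minus[OF has_real_derivative_reflect[OF this(2)]]
  show "((\<lambda>s. fst (fst (w (- s)), - snd (w (- s)))) has_real_derivative snd (fst (w (- t)), - snd (w (- t))))
      (at t within uminus ` I)"
    "((\<lambda>s. snd (fst (w (- s)), - snd (w (- s)))) has_real_derivative - g (fst (fst (w (- t)), - snd (w (- t)))))
      (at t within uminus ` I)"
    by simp_all
qed

context oscillator
begin

lemma psi_abs: "sqrt m * \<bar>x\<bar> \<le> \<bar>psi x\<bar>" "\<bar>psi x\<bar> \<le> sqrt M * \<bar>x\<bar>"
  using B_bounds[of x] B_pos[of x] by (simp_all add: psi_def abs_mult mult.commute[of "sqrt _"] mult_left_mono)

lemma sgn_psi: "sgn (psi x) = sgn x"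
  using B_pos[of x] by (simp add: psi_def sgn_mult)

lemma cont_psi: "isCont psi x"
  using DERIV_psi DERIV_isCont by blast

lemma G_lipschitz: "\<bar>G x - G y\<bar> \<le> M * \<bar>x - y\<bar>"
proof (induction x y rule: linorder_less_wlog)
  case (less x y)
  then obtain z where "G y - G x = (y - x) * G' z" using MVT2[OF _ DERIV_G] by blast
  then have "\<bar>G x - G y\<bar> = G' z * \<bar>x - y\<bar>"
    using less G'_bounds(1)[of z] m_pos
    by (metis abs_minus_commute abs_mult abs_of_pos less_le_trans mult.commute)
  then show ?case using G'_bounds(2)[of z] by (simp add: mult_right_mono)
next
  case (sym x y)
  then show ?case by (simp add: abs_minus_commute)
qed simp

lemma sys2_unique:
  assumes "sys2_solution UNIV G I w1" "sys2_solution UNIV G I w2"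
    and "s \<in> I" "w1 s = w2 s" "t \<in> I"
  shows "w1 t = w2 t"
proof -
  have "fst (w1 t) - fst (w2 t) = 0 \<and> snd (w1 t) - snd (w2 t) = 0"
  proof (rule second_order_zero[of I s t _ _ "\<lambda>t. - (G (fst (w1 t)) - G (fst (w2 t)))" M])
    show "((\<lambda>t. fst (w1 t) - fst (w2 t)) has_real_derivative snd (w1 t) - snd (w2 t)) (at t within I)"
      "((\<lambda>t. snd (w1 t) - snd (w2 t)) has_real_derivative - (G (fst (w1 t)) - G (fst (w2 t)))) (at t within I)"
      if "t \<in> I" for t
      using assms(1,2) that unfolding sys2_solution_def
      by (auto intro!: derivative_eq_intros)
    show "\<bar>- (G (fst (w1 t)) - G (fst (w2 t)))\<bar> \<le> M * \<bar>fst (w1 t) - fst (w2 t)\<bar>" for t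
      using G_lipschitz by (simp only: abs_minus_cancel)
  qed (use assms in \<open>auto simp: sys2_solution_def\<close>)
  then show ?thesis by (simp add: prod_eq_iff)
qed

text \<open>As \<open>G'\<close> is merely continuous, the right-hand side need not be Lipschitz.
  Uniqueness is therefore obtained in two stages: first for the planar part, then for the
  y-equation, which is linear with a coefficient common to both solutions.\<close>

lemma sys4_unique:
  assumes z: "sys4_solution UNIV G I z1" "sys4_solution UNIV G I z2"
    and s: "s \<in> I" "z1 s = z2 s" and t: "t \<in> I"
  shows "z1 t = z2 t"
proof -
  have eq: "(fst (z1 t), fst (snd (snd (z1 t)))) = (fst (z2 t), fst (snd (snd (z2 t))))" if "t \<in> I" for t
    by (rule sys2_unique[OF z[THEN sys4_solution_sys2] s(1) _ that]) (simp add: s(2))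
  let ?u = "\<lambda>t. fst (snd (z1 t)) - fst (snd (z2 t))"
  let ?v = "\<lambda>t. snd (snd (snd (z1 t))) - snd (snd (snd (z2 t)))"
  have "?u t = 0 \<and> ?v t = 0"
  proof (rule second_order_zero[of I s t ?u ?v "\<lambda>t. - G' (fst (z1 t)) * ?u t" M])
    show "(?u has_real_derivative ?v t) (at t within I)" if "t \<in> I" for t
      using z that unfolding sys4_solution_def by (auto intro!: derivative_eq_intros)
    show "(?v has_real_derivative - G' (fst (z1 t)) * ?u t) (at t within I)" if "t \<in> I" for t
    proof -
      have "((\<lambda>t. snd (snd (snd (z1 t)))) has_real_derivative - G' (fst (z1 t)) * fst (snd (z1 t))) (at t within I)"
        "((\<lambda>t. snd (snd (snd (z2 t)))) has_real_derivative - G' (fst (z1 t)) * fst (snd (z2 t))) (at t within I)"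
        using z that eq[OF that] unfolding sys4_solution_def deriv_G prod.inject by metis+
      from DERIV_diff[OF this] show ?thesis by (simp add: algebra_simps)
    qed
    show "\<bar>- G' (fst (z1 t)) * ?u t\<bar> \<le> M * \<bar>?u t\<bar>" for t
      using G'_bounds[of "fst (z1 t)"] m_pos by (simp add: abs_mult mult_right_mono)
  qed (use s t z in \<open>auto simp: sys4_solution_def\<close>)
  then show ?thesis using eq[OF t] by (simp add: prod_eq_iff)
qed

end

section \<open>Transfer between the local force and its extension\<close>

locale local_oscillator = oscillator +
  fixes g :: "real \<Rightarrow> real" and U :: "real set" and \<rho> :: real
  assumes rho_pos: "\<rho> > 0"
    and local: "\<And>x. \<bar>x\<bar> < \<rho> \<Longrightarrow> x \<in> U \<and> g x = G x \<and> deriv g x = G' x"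
begin

text \<open>By the lower bound in \<open>psi_abs\<close>, amplitudes below \<open>R\<close> keep |x|
  below \<rho>, where g and \<open>G\<close> agree.\<close>

definition "R = sqrt m * \<rho>"

lemma R_pos: "R > 0"
  using m_pos rho_pos by (simp add: R_def)

lemma psi_small: "\<bar>psi x\<bar> < R \<Longrightarrow> \<bar>x\<bar> < \<rho>"
proof -
  assume "\<bar>psi x\<bar> < R"
  then have "sqrt m * \<bar>x\<bar> < sqrt m * \<rho>" using psi_abs(1)[of x] by (simp add: R_def)
  then show ?thesis using m_pos by simp
qed

text \<open>Up to the first time u with |x| \<ge> \<rho> the force is \<open>G\<close>, so the
  energy H is conserved. At u the potential part alone is at least \<open>R\<^sup>2\<close>,
  contradicting the initial value.\<close>

lemma confined_forward:
  assumes w: "sys2_solution U g I w" and st: "s \<in> I" "t \<in> I" "s \<le> t"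
    and small: "(psi (fst (w s)))\<^sup>2 + (snd (w s))\<^sup>2 < R\<^sup>2"
  shows "\<bar>fst (w t)\<bar> < \<rho>"
proof (rule ccontr)
  assume contra: "\<not> \<bar>fst (w t)\<bar> < \<rho>"
  define H where "H t = 2 * potential G (fst (w t)) + (snd (w t))\<^sup>2" for t
  have I: "is_interval I" and D: "\<And>t. t \<in> I \<Longrightarrow> ((\<lambda>s. fst (w s)) has_real_derivative snd (w t)) (at t within I)"
     "\<And>t. t \<in> I \<Longrightarrow> ((\<lambda>s. snd (w s)) has_real_derivative - g (fst (w t))) (at t within I)"
    using w by (auto simp: sys2_solution_def)
  have sub: "{s..t} \<subseteq> I" using I st interval_segment by blast
  have cont: "continuous_on {s..t} (\<lambda>t. fst (w t))" "continuous_on {s..t} (\<lambda>t. snd (w t))"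
    by (rule continuous_on_subset[OF DERIV_continuous_on sub], erule D)+
  define S where "S = {u \<in> {s..t}. \<rho> \<le> \<bar>fst (w u)\<bar>}"
  have "closed S" unfolding S_def
    by (intro continuous_on_closed_Collect_le continuous_on_const continuous_on_rabs[OF cont(1)]) auto
  moreover have "bounded S" unfolding S_def by (rule bounded_subset[of "{s..t}"]) auto
  moreover have "S \<noteq> {}" using contra st by (auto simp: S_def)
  ultimately obtain u where u: "u \<in> S" "\<And>y. y \<in> S \<Longrightarrow> u \<le> y"
    using compact_attains_inf[of S] compact_eq_bounded_closed by blast
  have us: "s \<le> u" "u \<le> t" "\<rho> \<le> \<bar>fst (w u)\<bar>" using u(1) by (auto simp: S_def)
  have "H u = H s"
  proof (cases "s = u")
    case False
    show ?thesis
    proof (rule DERIV_isconst_end[of s u H])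
      show "continuous_on {s..u} H"
        unfolding H_def
        by (intro continuous_on_add continuous_on_mult_left continuous_on_power continuous_on_compose2[OF continuous_on_potential[OF cont_G, of UNIV]]
              continuous_on_subset[OF cont(1)] continuous_on_subset[OF cont(2)]) (use us in auto)
      show "(H has_real_derivative 0) (at y)" if y: "s < y" "y < u" for y
      proof -
        have yI: "y \<in> I" and "y \<notin> S" using sub y us u(2)[of y] by auto
        then have "\<bar>fst (w y)\<bar> < \<rho>" using y us by (auto simp: S_def)
        then have g: "g (fst (w y)) = G (fst (w y))" using local by blast
        have "at y within I = at y"
          by (rule at_within_interior_Ioo[of s u]) (use sub us y in auto)
        with D[OF yI] g have "((\<lambda>s. fst (w s)) has_real_derivative snd (w y)) (at y)"
          "((\<lambda>s. snd (w s)) has_real_derivative - G (fst (w y))) (at y)" by simp_all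
        then show ?thesis unfolding H_def
          by (auto intro!: derivative_eq_intros DERIV_chain2[OF DERIV_V])
      qed
    qed (use False us in auto)
  qed simp
  moreover have "H s < R\<^sup>2" using small by (simp add: H_def psi_sq)
  moreover have "R\<^sup>2 \<le> H u"
  proof -
    have "R \<le> \<bar>psi (fst (w u))\<bar>" using psi_small[of "fst (w u)"] us(3) by linarith
    then have "R\<^sup>2 \<le> (psi (fst (w u)))\<^sup>2" using R_pos by (metis abs_le_square_iff abs_of_pos)
    then show ?thesis unfolding H_def psi_sq[symmetric] by (simp add: add_increasing2)
  qed
  ultimately show False by simp
qed

text \<open>Reversing time flips only the sign of the velocity, which the energy does not see; so
  the forward result also covers earlier times.\<close>

lemma confined:
  assumes w: "sys2_solution U g I w" and st: "s \<in> I" "t \<in> I"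
    and small: "(psi (fst (w s)))\<^sup>2 + (snd (w s))\<^sup>2 < R\<^sup>2"
  shows "\<bar>fst (w t)\<bar> < \<rho>"
proof (cases "s \<le> t")
  case False
  then show ?thesis
    using confined_forward[OF sys2_solution_reflect[OF w], of "- s" "- t"] st small by simp
qed (use confined_forward assms in blast)

lemma sys2_local_iff:
  "(\<And>t. t \<in> I \<Longrightarrow> \<bar>fst (w t)\<bar> < \<rho>) \<Longrightarrow> sys2_solution U g I w \<longleftrightarrow> sys2_solution UNIV G I w"
  unfolding sys2_solution_def using local by auto

lemma sys4_local_iff:
  "(\<And>t. t \<in> I \<Longrightarrow> \<bar>fst (z t)\<bar> < \<rho>) \<Longrightarrow> sys4_solution U g I z \<longleftrightarrow> sys4_solution UNIV G I z"
  unfolding sys4_solution_def deriv_G using local by auto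

lemma phi_small:
  assumes "0 \<le> r" "r < R"
  shows "\<bar>phi (r * sin u)\<bar> < \<rho>"
proof (rule psi_small)
  have "r * \<bar>sin u\<bar> \<le> r * 1" using assms by (intro mult_left_mono) auto
  then show "\<bar>psi (phi (r * sin u))\<bar> < R" using assms by (simp add: abs_mult)
qed

lemma Z_local_solution:
  assumes "0 \<le> r" "r < R" "is_interval I"
  shows "sys4_solution U g I (\<lambda>t. Z r a b (th r (t + t0)))"
  using Z_solution[OF assms(3)] phi_small[OF assms(1,2)]
  by (subst sys4_local_iff) (auto simp: Z_def)

text \<open>Confinement turns a solution for g on any interval into one for \<open>G\<close>, where
  uniqueness identifies it with the explicit motion.\<close>

lemma solution_eq_Z:
  assumes z: "sys4_solution U g I z" and st: "s \<in> I" "t \<in> I"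
    and init: "z s = Z r a b (th r t0)" and r: "0 \<le> r" "r < R"
  shows "z t = Z r a b (th r (t - s + t0))"
proof -
  let ?w = "\<lambda>t. (fst (z t), fst (snd (snd (z t))))"
  have "(psi (fst (?w s)))\<^sup>2 + (snd (?w s))\<^sup>2 = r\<^sup>2"
    unfolding init by (simp add: Z_def power_mult_distrib flip: distrib_left)
  also have "\<dots> < R\<^sup>2" using r by (simp add: power_strict_mono)
  finally have "\<bar>fst (z t)\<bar> < \<rho>" if "t \<in> I" for t
    using confined[OF sys4_solution_sys2[OF z] st(1) that] by simp
  then have "sys4_solution UNIV G I z" using z sys4_local_iff by blast
  moreover have "sys4_solution UNIV G I (\<lambda>t. Z r a b (th r (t + (t0 - s))))"
    using Z_solution z by (simp add: sys4_solution_def)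
  ultimately have "z t = Z r a b (th r (t + (t0 - s)))"
    by (rule sys4_unique[OF _ _ st(1) _ st(2)]) (simp add: init)
  then show ?thesis by (simp add: algebra_simps)
qed

definition "W r u = (phi (r * sin u), r * cos u)"

text \<open>With zero variational part, \<open>Z\<close> carries the same information as the planar
  state, so minimal periods in the plane follow from those in four dimensions.\<close>

lemma W_Z: "W r u = W r u' \<longleftrightarrow> Z r 0 0 u = Z r 0 0 u'"
  by (simp add: W_def Z_def)

lemma W_local_solution:
  assumes "0 \<le> r" "r < R"
  shows "sys2_solution U g UNIV (\<lambda>t. W r (th r (t + t0)))"
  using sys4_solution_sys2[OF Z_local_solution[OF assms, of UNIV 0 0 t0]]
  by (simp add: Z_def W_def)

lemma solution_eq_W:
  assumes w: "sys2_solution U g UNIV w" and init: "w 0 = W r (th r t0)" and r: "0 \<le> r" "r < R"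
  shows "w t = W r (th r (t + t0))"
proof -
  have "(psi (fst (w 0)))\<^sup>2 + (snd (w 0))\<^sup>2 = r\<^sup>2"
    unfolding init by (simp add: W_def power_mult_distrib flip: distrib_left)
  also have "\<dots> < R\<^sup>2" using r by (simp add: power_strict_mono)
  finally have "\<bar>fst (w t)\<bar> < \<rho>" for t using confined[OF w] by blast
  then have "sys2_solution UNIV G UNIV w" using w sys2_local_iff by blast
  moreover have "sys2_solution UNIV G UNIV (\<lambda>t. W r (th r (t + t0)))"
    using sys4_solution_sys2[OF Z_solution[of UNIV r 0 0 t0]] by (simp add: Z_def W_def)
  ultimately show ?thesis
    by (rule sys2_unique[of _ _ _ 0]) (simp_all add: init)
qed

lemma W_period: "W r (th r (t + T r)) = W r (th r t)"
  by (simp add: W_def th_add_period)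

lemma W_minimal_period:
  assumes "r > 0" "0 < s" "s < T r"
  shows "W r (th r (t + s)) \<noteq> W r (th r t)"
proof -
  have "Z r 0 0 (th r t) \<noteq> 0"
  proof
    assume "Z r 0 0 (th r t) = 0"
    then have "psi (phi (r * sin (th r t))) = psi 0" "r * cos (th r t) = 0"
      by (simp_all add: Z_def zero_prod_def)
    then show False using assms(1) sin_cos_squared_add[of "th r t"] by simp
  qed
  then show ?thesis using Z_minimal_period assms by (simp add: W_Z)
qed

end

section \<open>Isochronism, stability and instability\<close>

lemma norm_le_sum4: "norm (x, y, v, w) \<le> \<bar>x\<bar> + \<bar>y\<bar> + \<bar>v\<bar> + \<bar>w\<bar>" for x y v w :: real
  using norm_Pair_le[of x "(y, v, w)"] norm_Pair_le[of y "(v, w)"] norm_Pair_le[of v w] by simp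

lemma abs_le_norm4:
  fixes x y v w :: real
  shows "\<bar>x\<bar> \<le> norm (x, y, v, w)" "\<bar>y\<bar> \<le> norm (x, y, v, w)"
    "\<bar>v\<bar> \<le> norm (x, y, v, w)" "\<bar>w\<bar> \<le> norm (x, y, v, w)"
  by (metis norm_fst_le norm_snd_le order_trans real_norm_def)+

context local_oscillator
begin

lemma amplitude_le: "sqrt ((psi x)\<^sup>2 + v\<^sup>2) \<le> (sqrt M + 1) * norm (x, v)"
proof -
  have "sqrt ((psi x)\<^sup>2 + v\<^sup>2) \<le> \<bar>psi x\<bar> + \<bar>v\<bar>" by (rule sqrt_sum_squares_le_sum_abs)
  also have "\<dots> \<le> sqrt M * \<bar>x\<bar> + \<bar>v\<bar>" using psi_abs(2) by simp
  also have "\<dots> \<le> sqrt M * norm (x, v) + norm (x, v)"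
    using norm_fst_le[of x v] norm_snd_le[of v x] M_pos by (intro add_mono mult_left_mono) auto
  finally show ?thesis by (simp add: algebra_simps)
qed

lemma potential_g: "\<bar>x\<bar> < \<rho> \<Longrightarrow> 2 * potential g x = (psi x)\<^sup>2"
  unfolding psi_sq by (subst potential_cong[of x g G]) (use local in auto)

text \<open>The orbit through \<open>(phi r, 0)\<close> has amplitude r and minimal period
  \<open>T r\<close>. Isochronism makes \<open>T\<close> constant for small r, so its derivative
  \<open>q r / r\<close> vanishes.\<close>

lemma isochronousE:
  assumes "loc_iso_center U g"
  obtains R' where "R' > 0" "R' \<le> R" "\<forall>r\<in>{0<..<R'}. q r = 0"
proof -
  obtain a b where a: "a < 0" and b: "0 < b" and "\<exists>T>0. \<forall>x0\<in>{a<..<b}. x0 \<noteq> 0 \<longrightarrow>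
      (\<exists>w. sys2_solution U g UNIV w \<and> w 0 = (x0, 0) \<and>
           (\<forall>t. w (t + T) = w t) \<and> (\<forall>s\<in>{0<..<T}. w s \<noteq> w 0))"
    using assms unfolding loc_iso_center_def by (elim exE conjE) blast
  then obtain T1 where T1: "T1 > 0"
    and per: "\<forall>x0\<in>{a<..<b}. x0 \<noteq> 0 \<longrightarrow>
      (\<exists>w. sys2_solution U g UNIV w \<and> w 0 = (x0, 0) \<and>
           (\<forall>t. w (t + T1) = w t) \<and> (\<forall>s\<in>{0<..<T1}. w s \<noteq> w 0))"
    by blast
  \<comment> \<open>The bound \<open>psi b\<close> ensures \<open>phi r < b\<close>; the bound
    \<open>R\<close> ensures confinement.\<close>
  define R' where "R' = min R (psi b)"
  have "psi b > 0" using psi_less_iff[of 0 b] b by simp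
  then have R': "R' > 0" "R' \<le> R" using R_pos by (auto simp: R'_def)
  have "T r = T1" if r: "r \<in> {0<..<R'}" for r
  proof -
    have rR: "0 < r" "r < R" "r < psi b" using r by (auto simp: R'_def)
    have "phi r < phi (psi b)" "phi 0 < phi r" using rR by (simp_all only: phi_less_iff)
    then have "0 < phi r" "phi r < b" by simp_all
    then obtain w where w: "sys2_solution U g UNIV w" "w 0 = (phi r, 0)"
      "\<And>t. w (t + T1) = w t" "\<And>s. s \<in> {0<..<T1} \<Longrightarrow> w s \<noteq> w 0"
      using per[rule_format, of "phi r"] a by auto
    \<comment> \<open>At angle \<open>pi / 2\<close> the velocity is 0 and the position is
      \<open>phi r\<close>.\<close>
    define t0 where "t0 = tau r (pi / 2)"
    have "w 0 = W r (th r t0)" using w(2) by (simp add: W_def t0_def)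
    from solution_eq_W[OF w(1) this] have eq: "w t = W r (th r (t + t0))" for t
      using rR by simp
    have "\<not> T r < T1"
      using w(4)[of "T r"] T_pos[of r] W_period[of r t0] by (auto simp: eq add.commute)
    moreover have "\<not> T1 < T r"
      using w(3)[of 0] W_minimal_period[OF rR(1) T1, of t0] by (auto simp: eq add.commute)
    ultimately show ?thesis by simp
  qed
  then have "\<forall>r\<in>{0<..<R'}. q r = 0" using q_zero by blast
  with R' that show ?thesis by blast
qed

text \<open>In the coordinate \<open>psi\<close> the potential is half the square, so the interval
  is taken symmetric in \<open>psi\<close> and the involution h is the reflection
  \<open>phi (- psi x)\<close>. The common period is \<open>T 0\<close>.\<close>

lemma isochronousI:
  assumes R': "R' > 0" "R' \<le> R" and q: "\<forall>r\<in>{0<..<R'}. q r = 0"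
  shows "loc_iso_center U g"
proof -
  define a b where "a = phi (- R')" and "b = phi R'"
  have "phi (- R') < phi 0" "phi 0 < phi R'" using R' by (simp_all only: phi_less_iff)
  then have ab: "a < 0" "0 < b" by (simp_all add: a_def b_def)
  have mem: "x \<in> {a<..<b} \<longleftrightarrow> \<bar>psi x\<bar> < R'" for x
    using phi_less_iff[of "- R'" "psi x"] phi_less_iff[of "psi x" R']
    by (auto simp: a_def b_def simp del: phi_less_iff)
  have small: "\<bar>x\<bar> < \<rho>" if "x \<in> {a<..<b}" for x
    using that mem psi_small R' by force
  have pot: "2 * potential g x = (psi x)\<^sup>2" if "x \<in> {a<..<b}" for x
    using small[OF that] by (rule potential_g)
  show ?thesis
    unfolding loc_iso_center_def
  proof (rule exI[of _ a], rule exI[of _ b], intro conjI ballI impI)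
    show "{a<..<b} \<subseteq> U" using small local by blast
    show "potential g x < potential g y" if "x \<in> {0<..<b}" "y \<in> {0<..<b}" "x < y" for x y
    proof -
      have "0 < psi x" "psi x < psi y" using psi_less_iff[of 0 x] that by auto
      then have "(psi x)\<^sup>2 < (psi y)\<^sup>2" by (intro power_strict_mono) auto
      then show ?thesis using pot[of x] pot[of y] that ab by simp
    qed
    show "potential g y < potential g x" if "x \<in> {a<..<0}" "y \<in> {a<..<0}" "x < y" for x y
    proof -
      have "0 < - psi y" "- psi y < - psi x" using psi_less_iff[of y 0] that by auto
      then have "(- psi y)\<^sup>2 < (- psi x)\<^sup>2" by (intro power_strict_mono) auto
      then show ?thesis using pot[of x] pot[of y] that ab by simp
    qed
    show "\<exists>!h. h \<in> {a<..<b} \<and> potential g h = potential g x \<and> sgn h = - sgn x" if x: "x \<in> {a<..<b}" for x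
    proof (rule ex1I[of _ "phi (- psi x)"])
      have "phi (- psi x) \<in> {a<..<b}" using mem x by simp
      moreover have "sgn (phi (- psi x)) = - sgn x"
        by (metis psi_phi sgn_psi sgn_minus)
      ultimately show "phi (- psi x) \<in> {a<..<b} \<and> potential g (phi (- psi x)) = potential g x \<and>
          sgn (phi (- psi x)) = - sgn x"
        using pot[OF x] pot[of "phi (- psi x)"] by simp
      fix h assume h: "h \<in> {a<..<b} \<and> potential g h = potential g x \<and> sgn h = - sgn x"
      then have "(psi h)\<^sup>2 = (psi x)\<^sup>2" using pot[OF x] pot[of h] by simp
      then have "psi h = psi x \<or> psi h = - psi x" by (simp add: power2_eq_iff)
      moreover have "psi h = - psi x" if "psi h = psi x"
      proof -
        \<comment> \<open>The sign condition excludes the root \<open>psi h = psi x\<close> unless x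
          = 0, where both roots coincide.\<close>
        have "sgn x = - sgn x" using h that sgn_psi by metis
        then have "x = 0" by (simp add: sgn_if split: if_splits)
        then show ?thesis using that by simp
      qed
      ultimately have "psi h = - psi x" by blast
      then show "h = phi (- psi x)" by (metis phi_psi)
    qed
    show "\<exists>T>0. \<forall>x0\<in>{a<..<b}. x0 \<noteq> 0 \<longrightarrow>
          (\<exists>w. sys2_solution U g UNIV w \<and> w 0 = (x0, 0) \<and>
               (\<forall>t. w (t + T) = w t) \<and> (\<forall>s\<in>{0<..<T}. w s \<noteq> w 0))"
    proof (intro exI[of _ "T 0"] conjI ballI impI T_pos)
      fix x0 assume x0: "x0 \<in> {a<..<b}" "x0 \<noteq> 0"
      define r where "r = \<bar>psi x0\<bar>"
      have "psi x0 \<noteq> 0" using x0(2) by (metis phi_0 phi_psi)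
      then have r: "0 < r" "r < R'" "r < R" using mem x0(1) R' by (auto simp: r_def)
      have Tr: "T r = T 0" by (rule T_const[OF q]) (use r in auto)
      \<comment> \<open>Points at rest have angle \<open>pi / 2\<close> or \<open>- pi / 2\<close>,
        according to the sign of x0.\<close>
      have "\<exists>u. r * sin u = psi x0 \<and> cos u = 0"
        by (rule exI[of _ "if psi x0 > 0 then pi / 2 else - pi / 2"]) (auto simp: r_def)
      then obtain u where u: "r * sin u = psi x0" "cos u = 0" by blast
      define w where "w t = W r (th r (t + tau r u))" for t
      have "sys2_solution U g UNIV w"
        unfolding w_def using r by (intro W_local_solution) auto
      moreover have "w 0 = (x0, 0)" by (simp add: w_def W_def u)
      moreover have "w (t + T 0) = w t" for t
        using W_period[of r "t + tau r u"] by (simp add: w_def Tr algebra_simps)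
      moreover have "w s \<noteq> w 0" if "s \<in> {0<..<T 0}" for s
        using W_minimal_period[OF r(1), of s "tau r u"] that by (simp add: w_def Tr algebra_simps)
      ultimately show "\<exists>w. sys2_solution U g UNIV w \<and> w 0 = (x0, 0) \<and>
               (\<forall>t. w (t + T 0) = w t) \<and> (\<forall>s\<in>{0<..<T 0}. w s \<noteq> w 0)" by blast
    qed
  qed (use ab in auto)
qed

text \<open>With bounded coefficients for all angles, every motion starting close to the origin
  satisfies \<open>norm (z t) \<le> Q * norm p\<close>.\<close>

lemma stableI:
  assumes R': "R' > 0" "R' \<le> R" and q: "\<forall>r\<in>{0<..<R'}. q r = 0"
  shows "lyap_stable U g"
proof -
  obtain C1 where C1: "C1 \<ge> 1"
    "\<And>r u. q r = 0 \<Longrightarrow> \<bar>c2 r u\<bar> \<le> C1 \<and> \<bar>d1 r u\<bar> \<le> C1 \<and> \<bar>d2 r u\<bar> \<le> C1"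
    using coeff_bounded_periodic by blast
  obtain C2 where C2: "C2 \<ge> 1"
    "\<And>x y v w. \<exists>u a b. 0 \<le> u \<and> (x, y, v, w) = Z (sqrt ((psi x)\<^sup>2 + v\<^sup>2)) a b u \<and>
       \<bar>a\<bar> \<le> C2 * (\<bar>y\<bar> + \<bar>w\<bar>) \<and> \<bar>b\<bar> \<le> C2 * (\<bar>y\<bar> + \<bar>w\<bar>)"
    using Z_param by metis
  define L where "L = sqrt M + 1"
  \<comment> \<open>The first summand covers x and its velocity; the second covers the four products
    in y and its velocity, each at most \<open>2 * (C1 * C2) * norm p\<close>.\<close>
  define Q where "Q = (1 / sqrt m + 1) * L + 8 * (C1 * C2)"
  have L: "L > 0" using M_pos by (simp add: L_def add_pos_pos)
  have "C1 * C2 > 0" using C1 C2 by simp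
  then have Q: "Q > 0" using L m_pos by (simp add: Q_def add_nonneg_pos)
  show ?thesis
    unfolding lyap_stable_def
  proof (intro allI impI)
    fix \<epsilon> :: real assume \<epsilon>: "\<epsilon> > 0"
    \<comment> \<open>The first bound controls the final norm; the second keeps the amplitude below
      R', where \<open>q\<close> vanishes.\<close>
    define \<delta> where "\<delta> = min (\<epsilon> / Q) (R' / L)"
    have \<delta>: "\<delta> > 0" "Q * \<delta> \<le> \<epsilon>" "L * \<delta> \<le> R'"
      using \<epsilon> Q L R'(1) by (simp_all add: \<delta>_def min_def field_simps)
    show "\<exists>\<delta>>0. \<forall>p. norm p < \<delta> \<longrightarrow> (\<exists>z. sys4_solution U g {0..} z \<and> z 0 = p) \<and>
        (\<forall>z I. sys4_solution U g I z \<and> 0 \<in> I \<and> I \<subseteq> {0..} \<and> z 0 = p \<longrightarrow> (\<forall>t\<in>I. norm (z t) < \<epsilon>))"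
    proof (intro exI[of _ \<delta>] conjI \<delta>(1) allI impI ballI)
      fix p :: "real \<times> real \<times> real \<times> real" assume p: "norm p < \<delta>"
      obtain x y v w where xyvw: "p = (x, y, v, w)" by (cases p)
      define r where "r = sqrt ((psi x)\<^sup>2 + v\<^sup>2)"
      have "norm (x, v) \<le> norm p"
        by (simp add: xyvw norm_Pair)
      then have rL: "r \<le> L * norm p"
        using amplitude_le[of x v] mult_left_mono[of "norm (x, v)" "norm p" L] L
        unfolding r_def L_def by linarith
      moreover have "L * norm p < L * \<delta>" using p L by simp
      ultimately have r: "0 \<le> r" "r < R'" "r < R" using \<delta>(3) R'(2) by (auto simp: r_def)
      have q0: "q r = 0" using q r by (cases "r = 0") (auto simp: q_def)
      obtain u a b where Z: "p = Z r a b u" and ab: "\<bar>a\<bar> \<le> C2 * (\<bar>y\<bar> + \<bar>w\<bar>)" "\<bar>b\<bar> \<le> C2 * (\<bar>y\<bar> + \<bar>w\<bar>)"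
        using C2(2)[of x y v w] unfolding xyvw r_def by blast
      have "C2 * (\<bar>y\<bar> + \<bar>w\<bar>) \<le> C2 * (2 * norm p)"
        using abs_le_norm4[of y x v w] abs_le_norm4[of w x y v] C2(1) unfolding xyvw
        by (intro mult_left_mono) (auto intro: order_trans)
      with ab have ab: "\<bar>a\<bar> \<le> 2 * C2 * norm p" "\<bar>b\<bar> \<le> 2 * C2 * norm p" by simp_all
      let ?t0 = "tau r u"
      show "\<exists>z. sys4_solution U g {0..} z \<and> z 0 = p"
        using Z_local_solution[OF r(1,3), of "{0..}" a b ?t0]
        by (intro exI[of _ "\<lambda>t. Z r a b (th r (t + ?t0))"]) (simp add: Z is_interval_ci)
      have bound: "norm (Z r a b s) \<le> Q * norm p" for s
      proof -
        have prod: "\<bar>c * d\<bar> \<le> 2 * (C1 * C2) * norm p" if "\<bar>c\<bar> \<le> 2 * C2 * norm p" "\<bar>d\<bar> \<le> C1" for c d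
          using mult_mono[OF that] C2(1) by (simp add: abs_mult mult_ac)
        have "\<bar>cos s\<bar> \<le> C1" using C1(1) abs_cos_le_one[of s] by linarith
        with C1(2)[OF q0, of s]
        have "\<bar>a * cos s\<bar> \<le> 2 * (C1 * C2) * norm p" "\<bar>b * c2 r s\<bar> \<le> 2 * (C1 * C2) * norm p"
          "\<bar>a * d1 r s\<bar> \<le> 2 * (C1 * C2) * norm p" "\<bar>b * d2 r s\<bar> \<le> 2 * (C1 * C2) * norm p"
          by (simp_all add: prod ab)
        moreover have "\<bar>phi (r * sin s)\<bar> \<le> 1 / sqrt m * (L * norm p)"
        proof -
          have "sqrt m * \<bar>phi (r * sin s)\<bar> \<le> \<bar>r * sin s\<bar>"
            using psi_abs(1)[of "phi (r * sin s)"] by simp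
          also have "\<dots> \<le> r * 1"
            unfolding abs_mult using r by (intro mult_mono) auto
          finally show ?thesis using rL m_pos by (simp add: field_simps)
        qed
        moreover have "\<bar>r * cos s\<bar> \<le> L * norm p"
          using rL r mult_mono[of r "L * norm p" "\<bar>cos s\<bar>" 1] by (simp add: abs_mult)
        moreover have "\<bar>a * cos s + b * c2 r s\<bar> \<le> \<bar>a * cos s\<bar> + \<bar>b * c2 r s\<bar>"
          "\<bar>a * d1 r s + b * d2 r s\<bar> \<le> \<bar>a * d1 r s\<bar> + \<bar>b * d2 r s\<bar>"
          by (rule abs_triangle_ineq)+
        moreover have "norm (Z r a b s) \<le> \<bar>phi (r * sin s)\<bar> + \<bar>a * cos s + b * c2 r s\<bar> + \<bar>r * cos s\<bar>
            + \<bar>a * d1 r s + b * d2 r s\<bar>"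
          unfolding Z_def by (rule norm_le_sum4)
        moreover have "Q * norm p = 1 / sqrt m * (L * norm p) + L * norm p + 8 * (C1 * C2 * norm p)"
          by (simp add: Q_def algebra_simps)
        ultimately show ?thesis by linarith
      qed
      fix z I t assume z: "sys4_solution U g I z \<and> 0 \<in> I \<and> I \<subseteq> {0..} \<and> z 0 = p" and t: "t \<in> I"
      have "z t = Z r a b (th r (t - 0 + ?t0))"
        by (rule solution_eq_Z[of I z 0 t r a b ?t0]) (use z t r in \<open>auto simp: Z\<close>)
      then have "norm (z t) \<le> Q * norm p" using bound by simp
      also have "\<dots> < Q * \<delta>" using p Q by simp
      finally show "norm (z t) < \<epsilon>" using \<delta>(2) by simp
    qed
  qed
qed

text \<open>There are arbitrarily small amplitudes with \<open>q r \<noteq> 0\<close>. Starting at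
  angle 0 with a = 0 and a small nonzero b gives initial data \<open>(0, 0, r, b)\<close> near the
  origin and a motion growing linearly from turn to turn.\<close>

lemma unbounded_solutions:
  assumes "\<And>R'. R' > 0 \<Longrightarrow> R' \<le> R \<Longrightarrow> \<exists>r\<in>{0<..<R'}. q r \<noteq> 0"
  obtains P where "P \<longlonglongrightarrow> 0"
    "\<And>n::nat. \<exists>z. sys4_solution U g UNIV z \<and> z 0 = P n \<and> \<not> bounded (z ` {0..})"
proof -
  define \<eta> :: "nat \<Rightarrow> real" where "\<eta> n = inverse (real (Suc n))" for n
  have \<eta>: "\<eta> n > 0" "\<eta> \<longlonglongrightarrow> 0" for n
    using LIMSEQ_inverse_real_of_nat by (simp_all add: \<eta>_def[abs_def])
  have "\<exists>r. 0 < r \<and> r < R \<and> r < \<eta> n \<and> q r \<noteq> 0" for n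
    using assms[of "min R (\<eta> n)"] R_pos \<eta>(1)[of n] by auto
  then obtain r where r: "\<And>n. 0 < r n" "\<And>n. r n < R" "\<And>n. r n < \<eta> n" "\<And>n. q (r n) \<noteq> 0"
    by metis
  have "r \<longlonglongrightarrow> 0"
    by (rule tendsto_sandwich[OF _ _ tendsto_const \<eta>(2)])
       (use r in \<open>auto intro!: always_eventually intro: less_imp_le\<close>)
  show ?thesis
  proof (rule that[of "\<lambda>n. (0, 0, r n, \<eta> n)"])
    show "(\<lambda>n. (0, 0, r n, \<eta> n)) \<longlonglongrightarrow> 0"
      unfolding zero_prod_def by (intro tendsto_Pair tendsto_const \<open>r \<longlonglongrightarrow> 0\<close> \<eta>(2))
    fix n
    have th0: "th (r n) 0 = 0" using th_tau[of "r n" 0] by simp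
    show "\<exists>z. sys4_solution U g UNIV z \<and> z 0 = (0, 0, r n, \<eta> n) \<and> \<not> bounded (z ` {0..})"
    proof (intro exI[of _ "\<lambda>t. Z (r n) 0 (\<eta> n) (th (r n) (t + 0))"] conjI)
      show "sys4_solution U g UNIV (\<lambda>t. Z (r n) 0 (\<eta> n) (th (r n) (t + 0)))"
        by (rule Z_local_solution) (use r in \<open>auto intro: less_imp_le\<close>)
      show "Z (r n) 0 (\<eta> n) (th (r n) (0 + 0)) = (0, 0, r n, \<eta> n)"
        by (simp add: th0 Z_def c2_def d2_def)
      show "\<not> bounded ((\<lambda>t. Z (r n) 0 (\<eta> n) (th (r n) (t + 0))) ` {0..})"
        using Z_unbounded[OF r(4), of "\<eta> n" n] \<eta>(1)[of n] by simp
    qed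
  qed
qed

lemma not_stableI:
  assumes "P \<longlonglongrightarrow> 0"
    "\<And>n::nat. \<exists>z. sys4_solution U g UNIV z \<and> z 0 = P n \<and> \<not> bounded (z ` {0..})"
  shows "\<not> lyap_stable U g"
proof
  assume "lyap_stable U g"
  then obtain \<delta> where \<delta>: "\<delta> > 0" "\<And>p z I t. norm p < \<delta> \<Longrightarrow> sys4_solution U g I z \<Longrightarrow> 0 \<in> I \<Longrightarrow>
      I \<subseteq> {0..} \<Longrightarrow> z 0 = p \<Longrightarrow> t \<in> I \<Longrightarrow> norm (z t) < 1"
    unfolding lyap_stable_def by (metis zero_less_one)
  obtain n where n: "norm (P n) < \<delta>"
    using LIMSEQ_D[OF assms(1) \<delta>(1)] by auto
  obtain z where z: "sys4_solution U g UNIV z" "z 0 = P n" "\<not> bounded (z ` {0..})"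
    using assms(2) by blast
  have "sys4_solution U g {0..} z"
    by (rule sys4_solution_subset[OF z(1)]) (auto simp: is_interval_ci)
  then have "norm (z t) < 1" if "t \<in> {0..}" for t
    using \<delta>(2)[OF n, of "{0..}" z t] z(2) that by simp
  then have "bounded (z ` {0..})"
    unfolding bounded_iff by (intro exI[of _ 1]) (auto intro: less_imp_le)
  with z(3) show False by blast
qed

text \<open>Two conserved quantities must vanish if the solution tends to 0: first the planar
  energy, so the amplitude is 0, and then the energy of the harmonic oscillation left in y.\<close>

lemma no_asymptotic_solution:
  assumes z: "sys4_solution U g {..a} z" and lim: "(z \<longlongrightarrow> 0) at_bot" and t: "t \<le> a"
  shows "z t = 0"
proof -
  define E where "E p = (psi (fst p))\<^sup>2 + (fst (snd (snd p)))\<^sup>2" for p :: "real \<times> real \<times> real \<times> real"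
  have "((\<lambda>t. psi (fst (z t))) \<longlongrightarrow> psi (fst (0 :: real \<times> real \<times> real \<times> real))) at_bot"
    by (intro isCont_tendsto_compose[OF cont_psi] tendsto_fst lim)
  then have "((\<lambda>t. E (z t)) \<longlongrightarrow> (psi (fst (0 :: real \<times> real \<times> real \<times> real)))\<^sup>2
      + (fst (snd (snd (0 :: real \<times> real \<times> real \<times> real))))\<^sup>2) at_bot"
    unfolding E_def by (intro tendsto_intros lim)
  then have E: "((\<lambda>t. E (z t)) \<longlongrightarrow> 0) at_bot" by simp
  have "\<forall>\<^sub>F t in at_bot. E (z t) < R\<^sup>2"
    using order_tendstoD(2)[OF E] R_pos by simp
  then have "\<forall>\<^sub>F t in at_bot. E (z t) < R\<^sup>2 \<and> t \<le> a"
    using eventually_le_at_bot by (rule eventually_conj)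
  \<comment> \<open>The amplitude at s is below \<open>R\<close>, so \<open>solution_eq_Z\<close>
    describes the motion at every t \<le> a, before and after s.\<close>
  then obtain s where s: "E (z s) < R\<^sup>2" "s \<le> a"
    by (auto simp: eventually_at_bot_linorder)
  obtain x y v w where xyvw: "z s = (x, y, v, w)" by (cases "z s")
  define r where "r = sqrt ((psi x)\<^sup>2 + v\<^sup>2)"
  have "r < sqrt (R\<^sup>2)"
    unfolding r_def using s(1) by (intro real_sqrt_less_mono) (simp add: E_def xyvw)
  then have r: "0 \<le> r" "r < R" using R_pos by (simp_all add: r_def)
  obtain u c d where "z s = Z r c d u"
    using Z_param unfolding xyvw r_def by meson
  then have "z s = Z r c d (th r (tau r u))" by simp
  from solution_eq_Z[OF z _ _ this r]
  have zt: "z t = Z r c d (th r (t - s + tau r u))" if "t \<le> a" for t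
    using s that by simp
  have const: "k = 0" if "\<And>t. t \<le> a \<Longrightarrow> h t = k" "(h \<longlongrightarrow> 0) at_bot" for h :: "real \<Rightarrow> real" and k
  proof -
    have "\<forall>\<^sub>F t in at_bot. h t = k"
      using that(1) by (auto intro: eventually_mono[OF eventually_le_at_bot[of a]])
    then have "(h \<longlongrightarrow> k) at_bot" by (rule tendsto_eventually)
    with that(2) show ?thesis by (intro tendsto_unique[of at_bot h]) auto
  qed
  have "E (z t) = r\<^sup>2" if "t \<le> a" for t
    unfolding zt[OF that] E_def by (simp add: Z_def power_mult_distrib flip: distrib_left)
  from const[OF this E] have "r\<^sup>2 = 0" .
  then have r0: "r = 0" by simp
  \<comment> \<open>By \<open>f_0_sq\<close> the weight \<open>(f 0)\<^sup>2\<close> is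
    \<open>1 / G' 0\<close>, so F is the energy of the linearised oscillator up to a constant
    factor.\<close>
  define F where "F p = (fst (snd p))\<^sup>2 + (f 0 * snd (snd (snd p)))\<^sup>2" for p :: "real \<times> real \<times> real \<times> real"
  have "((\<lambda>t. F (z t)) \<longlongrightarrow> (fst (snd (0 :: real \<times> real \<times> real \<times> real)))\<^sup>2
      + (f 0 * snd (snd (snd (0 :: real \<times> real \<times> real \<times> real))))\<^sup>2) at_bot"
    unfolding F_def by (intro tendsto_intros lim)
  then have F: "((\<lambda>t. F (z t)) \<longlongrightarrow> 0) at_bot" by simp
  have nz: "f 0 \<noteq> 0" using f_pos[of 0] by simp
  have "F (z t) = c\<^sup>2 + (d * f 0)\<^sup>2" if "t \<le> a" for t
  proof -
    let ?S = "sin (th 0 (t - s + tau 0 u))" and ?C = "cos (th 0 (t - s + tau 0 u))"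
    have "F (z t) = (c * ?C + d * f 0 * ?S)\<^sup>2 + (f 0 * (d * ?C - c / f 0 * ?S))\<^sup>2"
      unfolding zt[OF that] r0 Z_zero_amplitude by (simp add: F_def)
    also have "f 0 * (d * ?C - c / f 0 * ?S) = d * f 0 * ?C - c * ?S"
      using nz by (simp add: algebra_simps)
    also have "(c * ?C + d * f 0 * ?S)\<^sup>2 + (d * f 0 * ?C - c * ?S)\<^sup>2 = (c\<^sup>2 + (d * f 0)\<^sup>2) * (?S\<^sup>2 + ?C\<^sup>2)"
      by algebra
    finally show ?thesis by simp
  qed
  from const[OF this F] have "c\<^sup>2 + (d * f 0)\<^sup>2 = 0" .
  then have "c = 0" "d = 0" using nz by (simp_all add: sum_power2_eq_zero_iff)
  then show ?thesis using zt[OF t] by (simp add: r0 Z_zero_amplitude zero_prod_def)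
qed

text \<open>The period depends on the amplitude alone, hence only the planar part of p has to be
  small; y and its velocity are arbitrary.\<close>

lemma common_period:
  assumes R': "R' > 0" "R' \<le> R" and q: "\<forall>r\<in>{0<..<R'}. q r = 0"
    and p: "(sqrt M + 1) * norm (fst p, fst (snd (snd p))) < R'"
  shows "(\<exists>z. sys4_solution U g UNIV z \<and> z 0 = p) \<and>
     (\<forall>z. sys4_solution U g UNIV z \<and> z 0 = p \<longrightarrow>
        (\<forall>t. z (t + T 0) = z t) \<and> (p \<noteq> 0 \<longrightarrow> (\<forall>s\<in>{0<..<T 0}. z s \<noteq> p)))"
proof -
  obtain x y v w where xyvw: "p = (x, y, v, w)" by (cases p)
  define r where "r = sqrt ((psi x)\<^sup>2 + v\<^sup>2)"
  have r: "0 \<le> r" "r < R'" "r < R"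
    using amplitude_le[of x v] p R' by (auto simp: r_def xyvw)
  obtain u a b where Z: "p = Z r a b u"
    using Z_param unfolding xyvw r_def by meson
  let ?t0 = "tau r u"
  have Tr: "T r = T 0" by (rule T_const[OF q]) (use r in auto)
  have q0: "q r = 0" using q r by (cases "r = 0") (auto simp: q_def)
  have "sys4_solution U g UNIV (\<lambda>t. Z r a b (th r (t + ?t0)))"
    by (rule Z_local_solution[OF r(1,3)]) simp
  moreover have "Z r a b (th r (0 + ?t0)) = p" by (simp add: Z)
  moreover have "(\<forall>t. z (t + T 0) = z t) \<and> (p \<noteq> 0 \<longrightarrow> (\<forall>s\<in>{0<..<T 0}. z s \<noteq> p))"
    if z: "sys4_solution U g UNIV z" "z 0 = p" for z
  proof -
    have zt: "z t = Z r a b (th r (t + ?t0))" for t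
      using solution_eq_Z[OF z(1), of 0 t r a b ?t0] z(2) r by (simp add: Z)
    have "z (t + T 0) = z t" for t
    proof -
      have "z (t + T 0) = Z r a b (th r (t + ?t0 + T r))" by (simp add: zt Tr add_ac)
      then show ?thesis by (simp only: th_add_period Z_add_period[OF q0] zt)
    qed
    moreover have "z s \<noteq> p" if "p \<noteq> 0" "s \<in> {0<..<T 0}" for s
      using Z_minimal_period[of r a b ?t0 s] that by (simp add: zt Z Tr add.commute)
    ultimately show ?thesis by blast
  qed
  ultimately show ?thesis by blast
qed

end

section \<open>Extension of g to a force on the whole line\<close>

lemma local_oscillator_exists:
  fixes g :: "real \<Rightarrow> real" and U :: "real set"
  assumes U: "open U" "0 \<in> U"
    and diff: "\<forall>x\<in>U. g differentiable (at x)"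
    and cont: "continuous_on U (deriv g)"
    and g: "g 0 = 0" "deriv g 0 > 0"
  obtains G G' m M \<rho> where "local_oscillator G G' m M g U \<rho>"
proof -
  define k where "k = deriv g 0"
  obtain e where e: "e > 0" "ball 0 e \<subseteq> U" using U open_contains_ball by blast
  have "isCont (deriv g) 0" using cont U continuous_on_eq_continuous_at by blast
  then obtain d where d: "d > 0" "\<And>x. dist x 0 < d \<Longrightarrow> dist (deriv g x) k < k / 2"
    unfolding continuous_at_eps_delta k_def using g(2) by (metis half_gt_zero)
  \<comment> \<open>Halving places the closed interval of radius \<rho> inside U and inside the
    range of the estimate on the derivative.\<close>
  define \<rho> where "\<rho> = min e d / 2"
  have \<rho>: "\<rho> > 0" "\<rho> < e" "\<rho> < d" using e d by (auto simp: \<rho>_def)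
  \<comment> \<open>Clamping the argument freezes the derivative of g outside the interval: it stays
    continuous and within \<open>k / 2\<close> of k everywhere. Integrating it yields the
    extension.\<close>
  define cl where "cl x = max (- \<rho>) (min \<rho> x)" for x
  have cl: "\<bar>cl x\<bar> \<le> \<rho>" for x using \<rho> by (auto simp: cl_def)
  have cl_id: "cl x = x" if "\<bar>x\<bar> \<le> \<rho>" for x using that by (auto simp: cl_def)
  have inU: "x \<in> U" if "\<bar>x\<bar> \<le> \<rho>" for x using that \<rho> e by (auto simp: subset_iff)
  define G' where "G' x = deriv g (cl x)" for x
  define G where "G = potential G'"
  have contG': "continuous_on UNIV G'"
    unfolding G'_def
    by (rule continuous_on_compose2[OF cont])
       (use cl inU in \<open>auto simp: cl_def intro!: continuous_intros\<close>)
  have DG: "(G has_real_derivative G' x) (at x)" for x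
    unfolding G_def by (rule has_real_derivative_potential[OF contG'])
  have eq: "g x = G x" if x: "\<bar>x\<bar> \<le> \<rho>" for x
  proof -
    have D: "((\<lambda>x. g x - G x) has_real_derivative 0) (at y within {- \<rho>..\<rho>})" if "y \<in> {- \<rho>..\<rho>}" for y
    proof -
      have y: "\<bar>y\<bar> \<le> \<rho>" using that by auto
      have "(g has_real_derivative deriv g y) (at y)"
        using diff inU[OF y] by (simp add: DERIV_deriv_iff_real_differentiable)
      from has_field_derivative_at_within[OF DERIV_diff[OF this DG[of y]]] show ?thesis
        by (rule DERIV_cong) (simp add: G'_def cl_id[OF y])
    qed
    have "\<exists>c. \<forall>x\<in>{- \<rho>..\<rho>}. g x - G x = c"
      by (rule has_field_derivative_zero_constant) (use D in auto)
    then have "g x - G x = g 0 - G 0" using x \<rho>(1) by force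
    then show ?thesis using g by (simp add: G_def)
  qed
  have "local_oscillator G G' (k / 2) (3 * k / 2) g U \<rho>"
  proof
    show "k / 2 > 0" using g by (simp add: k_def)
    show "k / 2 \<le> G' x" "G' x \<le> 3 * k / 2" for x
    proof -
      have "\<bar>deriv g (cl x) - k\<bar> < k / 2"
        using d(2)[of "cl x"] cl[of x] \<rho> by (simp add: dist_real_def)
      then show "k / 2 \<le> G' x" "G' x \<le> 3 * k / 2" by (simp_all add: G'_def abs_if split: if_splits)
    qed
    show "x \<in> U \<and> g x = G x \<and> deriv g x = G' x" if "\<bar>x\<bar> < \<rho>" for x
      using that inU eq cl_id by (simp add: G'_def)
    show "G 0 = 0" by (simp add: G_def)
  qed (use DG contG' \<rho> in auto)
  then show ?thesis by (rule that)
qed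

theorem theorem3p3:
  fixes g :: "real \<Rightarrow> real" and U :: "real set"
  assumes "open U" and "0 \<in> U"
    and "\<forall>x\<in>U. g differentiable (at x)"
    and "continuous_on U (deriv g)"
    and "g 0 = 0" and "deriv g 0 > 0"
  shows "(lyap_stable U g \<longleftrightarrow> loc_iso_center U g)
    \<and> (loc_iso_center U g \<longrightarrow>
         (\<exists>T>0. \<exists>r>0. \<forall>p. norm (fst p, fst (snd (snd p))) < r \<longrightarrow>
            (\<exists>z. sys4_solution U g UNIV z \<and> z 0 = p) \<and>
            (\<forall>z. sys4_solution U g UNIV z \<and> z 0 = p \<longrightarrow>
                 (\<forall>t. z (t + T) = z t) \<and> (p \<noteq> 0 \<longrightarrow> (\<forall>s\<in>{0<..<T}. z s \<noteq> p)))))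
    \<and> (\<not> lyap_stable U g \<longrightarrow>
         (\<exists>P :: nat \<Rightarrow> real \<times> real \<times> real \<times> real. P \<longlonglongrightarrow> 0 \<and>
             (\<forall>n. \<exists>z. sys4_solution U g UNIV z \<and> z 0 = P n \<and> \<not> bounded (range z))) \<and>
         (\<forall>z a. sys4_solution U g {..a} z \<and> (z \<longlongrightarrow> 0) at_bot \<longrightarrow> (\<forall>t\<le>a. z t = 0)))"
proof -
  obtain G G' m M \<rho> where "local_oscillator G G' m M g U \<rho>"
    using local_oscillator_exists[OF assms] .
  then interpret local_oscillator G G' m M g U \<rho> .
  \<comment> \<open>Vanishing of \<open>q\<close> for small amplitudes is the hinge: both
    isochronism and stability are shown equivalent to it.\<close>
  define Q where "Q \<longleftrightarrow> (\<exists>R'>0. R' \<le> R \<and> (\<forall>r\<in>{0<..<R'}. q r = 0))"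
  have iso: "loc_iso_center U g \<longleftrightarrow> Q"
    unfolding Q_def using isochronousE isochronousI by metis
  have unbdd: "\<exists>P :: nat \<Rightarrow> real \<times> real \<times> real \<times> real. P \<longlonglongrightarrow> 0 \<and>
      (\<forall>n. \<exists>z. sys4_solution U g UNIV z \<and> z 0 = P n \<and> \<not> bounded (z ` {0..}))" if "\<not> Q"
  proof -
    have "\<exists>r\<in>{0<..<R'}. q r \<noteq> 0" if "R' > 0" "R' \<le> R" for R'
      using \<open>\<not> Q\<close> that unfolding Q_def by blast
    from unbounded_solutions[OF this] show ?thesis by metis
  qed
  \<comment> \<open>If \<open>Q\<close> fails, the unbounded solutions starting arbitrarily near the
    origin contradict stability.\<close>
  have stable: "lyap_stable U g \<longleftrightarrow> Q"
    using unbdd not_stableI stableI unfolding Q_def by metis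
  show ?thesis
  proof (intro conjI impI)
    show "lyap_stable U g \<longleftrightarrow> loc_iso_center U g" using iso stable by simp
    assume "loc_iso_center U g"
    then obtain R' where R': "R' > 0" "R' \<le> R" "\<forall>r\<in>{0<..<R'}. q r = 0"
      by (rule isochronousE)
    have L: "sqrt M + 1 > 0" using M_pos by (simp add: add_pos_pos)
    show "\<exists>T>0. \<exists>r>0. \<forall>p. norm (fst p, fst (snd (snd p))) < r \<longrightarrow>
            (\<exists>z. sys4_solution U g UNIV z \<and> z 0 = p) \<and>
            (\<forall>z. sys4_solution U g UNIV z \<and> z 0 = p \<longrightarrow>
                 (\<forall>t. z (t + T) = z t) \<and> (p \<noteq> 0 \<longrightarrow> (\<forall>s\<in>{0<..<T}. z s \<noteq> p)))"
    proof (rule exI[of _ "T 0"], rule conjI[OF T_pos], rule exI[of _ "R' / (sqrt M + 1)"], intro conjI[of "0 < _"] allI impI)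
      show "0 < R' / (sqrt M + 1)" using R' L by simp
    qed (use common_period[OF R'] L in \<open>simp_all add: pos_less_divide_eq mult.commute\<close>)
  next
    assume "\<not> lyap_stable U g"
    then obtain P :: "nat \<Rightarrow> real \<times> real \<times> real \<times> real" where P: "P \<longlonglongrightarrow> 0"
      "\<And>n. \<exists>z. sys4_solution U g UNIV z \<and> z 0 = P n \<and> \<not> bounded (z ` {0..})"
      using unbdd stable by blast
    have "\<exists>z. sys4_solution U g UNIV z \<and> z 0 = P n \<and> \<not> bounded (range z)" for n
      using P(2)[of n] by (meson bounded_subset image_mono subset_UNIV)
    with P(1) show "\<exists>P :: nat \<Rightarrow> real \<times> real \<times> real \<times> real. P \<longlonglongrightarrow> 0 \<and>
             (\<forall>n. \<exists>z. sys4_solution U g UNIV z \<and> z 0 = P n \<and> \<not> bounded (range z))" by blast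
    show "\<forall>z a. sys4_solution U g {..a} z \<and> (z \<longlongrightarrow> 0) at_bot \<longrightarrow> (\<forall>t\<le>a. z t = 0)"
      using no_asymptotic_solution by blast
  qed
qed

end
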